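(* Let $T$ be a minimal IET. Suppose that the discontinuities of $T$ all belong to a single $T$-orbit. Then $T$ is conjugate (in the group $\mathbb{G}$ of all IETs) to a tower over a minimal rotation.
   Context: Interval exchange transformations (IETs): fix $m\in\mathbb{N}$, $m\ge 1$, a permutation $\pi$ of $\{1,\dots,m\}$, and $\lambda=(\lambda_1,\dots,\lambda_m)$ with $\lambda_i>0$ and $\sum_i\lambda_i=1$. Put $\beta_0=0$, $\beta_j=\lambda_1+\cdots+\lambda_j$, and $I_j=[\beta_{j-1},\beta_j)$ for $1\le j\le m$. The $m$-IET $T_{(\pi,\lambda)}:[0,1)\to[0,1)$ is the bijection given by $T_{(\pi,\lambda)}(x)=x-\sum_{i<j}\lambda_i+\sum_{\pi(i)<\pi(j)}\lambda_i$ for $x\in I_j$. The set of all IETs forms a group $\mathbb{G}$ under composition; conjugate means conjugate in $\mathbb{G}$. $T$ is minimal if every orbit $\{T^n(x):n\in\mathbb{Z}\}$ is dense in $[0,1)$. A rotation is a $2$-IET whose permutation interchanges $1$ and $2$. Towers: let $R$ be an $m$-IET exchanging the intervals $I_1,\dots,I_m$, and let $n_1,\dots,n_m$ be positive integers. Let $f:[0,1)\to\mathbb{N}$ with $f(x)=n_j$ for $x\in I_j$. On the set $\{(x,i):x\in[0,1),\ 1\le i\le f(x)\}$ define $R_f(x,i)=(x,i+1)$ if $i+1\le f(x)$, and $R_f(x,i)=(R(x),1)$ otherwise. Laying the levels of this domain (level $i$ consists of the intervals $I_j\times\{i\}$ with $n_j\ge i$) end to end and rescaling so that the total length is $1$,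 one views $R_f$ as an IET of $[0,1)$, called a tower of type $(n_1,\dots,n_m)$ over $R$. (Different arrangements of the intervals $I_j\times\{i\}$ inside $[0,1)$ give conjugate IETs.) *)

theory Defs
  imports "HOL-Analysis.Analysis" "HOL-Algebra.Bij" "HOL-Combinatorics.Permutations"
begin

section \<open>Interval exchange transformations of the unit interval\<close>

text \<open>
  Indices run over \<open>{1..m}\<close>; the values of the length vector \<open>l\<close> outside \<open>{1..m}\<close> are
  irrelevant.
\<close>

definition iet_data :: "nat \<Rightarrow> (nat \<Rightarrow> nat) \<Rightarrow> (nat \<Rightarrow> real) \<Rightarrow> bool" where
  "iet_data m p l \<longleftrightarrow> m \<ge> 1 \<and> p permutes {1..m} \<and> (\<forall>i\<in>{1..m}. l i > 0) \<and> (\<Sum>i\<in>{1..m}. l i) = 1"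

definition break_pt :: "(nat \<Rightarrow> real) \<Rightarrow> nat \<Rightarrow> real" where
  "break_pt l j = (\<Sum>i\<in>{1..j}. l i)"

definition iet_interval :: "(nat \<Rightarrow> real) \<Rightarrow> nat \<Rightarrow> real set" where
  "iet_interval l j = {break_pt l (j - 1) ..< break_pt l j}"

definition iet_index :: "nat \<Rightarrow> (nat \<Rightarrow> real) \<Rightarrow> real \<Rightarrow> nat" where
  "iet_index m l x = (THE j. j \<in> {1..m} \<and> x \<in> iet_interval l j)"

text \<open>
  Self-maps of \<open>[0,1)\<close> are represented by extensional functions (value \<open>undefined\<close> outside
  \<open>{0..<1}\<close>), as in \<open>Bij\<close> and \<open>BijGroup\<close>.
\<close>

definition iet_map :: "nat \<Rightarrow> (nat \<Rightarrow> nat) \<Rightarrow> (nat \<Rightarrow> real) \<Rightarrow> real \<Rightarrow> real" where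
  "iet_map m p l =
    (\<lambda>x\<in>{0..<1}.
      let j = iet_index m l x
      in x - (\<Sum>i | i \<in> {1..m} \<and> i < j. l i) + (\<Sum>i | i \<in> {1..m} \<and> p i < p j. l i))"

definition IETs :: "(real \<Rightarrow> real) set" where
  "IETs = {T. \<exists>m p l. iet_data m p l \<and> T = iet_map m p l}"

definition IET_group :: "(real \<Rightarrow> real) monoid" where
  "IET_group = (BijGroup {0..<1})\<lparr>carrier := IETs\<rparr>"

definition conjugate_in :: "('a, 'b) monoid_scheme \<Rightarrow> 'a \<Rightarrow> 'a \<Rightarrow> bool" where
  "conjugate_in G a b \<longleftrightarrow> a \<in> carrier G \<and> b \<in> carrier G \<and>
     (\<exists>g\<in>carrier G. b = g \<otimes>\<^bsub>G\<^esub> a \<otimes>\<^bsub>G\<^esub> inv\<^bsub>G\<^esub> g)"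

definition iet_orbit :: "(real \<Rightarrow> real) \<Rightarrow> real \<Rightarrow> real set" where
  "iet_orbit T x = {(T [^]\<^bsub>BijGroup {0..<1}\<^esub> n) x | n :: int. True}"

definition minimal_iet :: "(real \<Rightarrow> real) \<Rightarrow> bool" where
  "minimal_iet T \<longleftrightarrow> T \<in> IETs \<and> (\<forall>x\<in>{0..<1}. {0..<1} \<subseteq> closure (iet_orbit T x))"

text \<open>
  Continuity is that of a map on the subspace \<open>[0,1)\<close> of the line, so \<open>0\<close> is never a
  discontinuity of an IET.
\<close>

definition discontinuities :: "(real \<Rightarrow> real) \<Rightarrow> real set" where
  "discontinuities T = {x\<in>{0..<1}. \<not> continuous (at x within {0..<1}) T}"

definition rotation_data :: "(nat \<Rightarrow> nat) \<Rightarrow> (nat \<Rightarrow> real) \<Rightarrow> bool" where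
  "rotation_data p l \<longleftrightarrow> iet_data 2 p l \<and> p 1 = 2 \<and> p 2 = 1"


section \<open>Towers\<close>

definition tower_dom :: "nat \<Rightarrow> (nat \<Rightarrow> real) \<Rightarrow> (nat \<Rightarrow> nat) \<Rightarrow> (real \<times> nat) set" where
  "tower_dom m l n = {(x, i). x \<in> {0..<1} \<and> 1 \<le> i \<and> i \<le> n (iet_index m l x)}"

definition tower_step ::
  "nat \<Rightarrow> (nat \<Rightarrow> nat) \<Rightarrow> (nat \<Rightarrow> real) \<Rightarrow> (nat \<Rightarrow> nat) \<Rightarrow> real \<times> nat \<Rightarrow> real \<times> nat" where
  "tower_step m p l n =
    (\<lambda>(x, i). if i + 1 \<le> n (iet_index m l x) then (x, i + 1) else (iet_map m p l x, 1))"

text \<open>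
  The levels \<open>1, 2, \<dots>\<close> are laid end to end from left to right, level \<open>k\<close> consisting of
  the intervals \<open>I\<^sub>j \<times> {k}\<close> with \<open>k \<le> n j\<close>, in increasing order of \<open>j\<close> and
  without gaps. The position of \<open>(x, i)\<close> is thus the total length of the levels below \<open>i\<close>,
  plus the length of the part of level \<open>i\<close> to the left of the interval containing \<open>x\<close>, plus
  the offset of \<open>x\<close> in that interval; dividing by the total length rescales to \<open>[0,1)\<close>.
\<close>

definition tower_pos :: "nat \<Rightarrow> (nat \<Rightarrow> real) \<Rightarrow> (nat \<Rightarrow> nat) \<Rightarrow> real \<times> nat \<Rightarrow> real" where
  "tower_pos m l n =
    (\<lambda>(x, i). let j = iet_index m l x in
      ((\<Sum>k\<in>{1..<i}. \<Sum>j' | j' \<in> {1..m} \<and> k \<le> n j'. l j')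
        + (\<Sum>j' | j' \<in> {1..m} \<and> j' < j \<and> i \<le> n j'. l j')
        + (x - break_pt l (j - 1)))
      / (\<Sum>j'\<in>{1..m}. real (n j') * l j'))"

definition tower_iet ::
  "nat \<Rightarrow> (nat \<Rightarrow> nat) \<Rightarrow> (nat \<Rightarrow> real) \<Rightarrow> (nat \<Rightarrow> nat) \<Rightarrow> real \<Rightarrow> real" where
  "tower_iet m p l n =
    (\<lambda>y\<in>{0..<1}.
      tower_pos m l n (tower_step m p l n (inv_into (tower_dom m l n) (tower_pos m l n) y)))"

end

theory Submission
  imports Defs
begin

text \<open>
  The discontinuities are finitely many points of one orbit, so the forward orbits of all of them
  pass through a common point \<open>y\<^sub>0\<close>. Let \<open>Q\<close> be the finite set of points that reach
  \<open>y\<^sub>0\<close> in at most \<open>M\<close> steps, where \<open>M\<close> is large enough for \<open>Q\<close> to contain all discontinuities,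
  and let \<open>a = Max Q\<close>. The first return map to \<open>[a,1)\<close> can only be discontinuous at a point whose
  orbit meets a discontinuity or \<open>a\<close> no later than its first return. Such a point of \<open>(a,1)\<close> is a
  preimage of \<open>y\<^sub>0\<close>, and counting the steps to \<open>y\<^sub>0\<close> shows that there is at most one of them:
  the orbit of a second one would pass through the first one before reaching \<open>Q\<close>. So the first
  return map exchanges at most two intervals; it is not the identity, hence it is a rotation, the
  return time is constant on each of the two intervals, and \<open>T\<close> is the tower of the return times.
\<close>

section \<open>Intervals laid end to end\<close>

text \<open>Taking the largest point of \<open>Q\<close> serves two ends. The base
  \<open>[a,1)\<close> reaches the right end of the unit interval, so \<open>a\<close> is the only
  cut that the base itself adds, and \<open>a\<close> lies in \<open>Q\<close> like the
  discontinuities, so a single count of steps to \<open>y\<^sub>0\<close> treats them alike.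
  Moreover no point of \<open>(a,1)\<close> reaches \<open>y\<^sub>0\<close> within \<open>M\<close>
  steps, which is what a second exceptional point would violate. Minimality enters three times: it
  rules out the identity as return map, since \<open>a\<close> would be periodic; it makes the
  levels over the base cover \<open>[0,1)\<close>; and it passes to the rotation. The metric
  obstacle is the slope. An IET has slope one, whereas a tower rescales twice: the base
  \<open>[a,1)\<close> is stretched to \<open>[0,1)\<close>, and the whole tower is shrunk to length
  one. Kac's formula for the total length of the levels shows that the two factors cancel.
  Membership in the group is tested by being a bijection with finitely many breaks and slope one, so
  permutations and lengths of composites are never computed.\<close>

text \<open>
  Only breaks in the half-open \<open>{x<..y}\<close> matter: a break starts a new piece, so \<open>f\<close> is continuous
  from the right everywhere.
\<close>

definition piecewise_translation :: "real set \<Rightarrow> (real \<Rightarrow> real) \<Rightarrow> bool" where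
  "piecewise_translation F f \<longleftrightarrow> finite F \<and>
     (\<forall>x y. 0 \<le> x \<longrightarrow> x < y \<longrightarrow> y < 1 \<longrightarrow> {x<..y} \<inter> F = {} \<longrightarrow> f y - y = f x - x)"

lemma piecewise_translationD:
  assumes "piecewise_translation F f" "0 \<le> x" "x \<le> y" "y < 1" "{x<..y} \<inter> F = {}"
  shows "f y - y = f x - x"
  using assms unfolding piecewise_translation_def by (cases "x = y") auto

text \<open>Left end of a block when blocks of widths \<open>w\<close> are laid end to end from 0 in
  the order of the keys \<open>r\<close>. Three orders occur: the identity for the intervals of an
  IET, its permutation for their images, and a lexicographic key for the pieces of a tower.\<close>

definition block_start :: "('a \<Rightarrow> nat) \<Rightarrow> 'a set \<Rightarrow> ('a \<Rightarrow> real) \<Rightarrow> 'a \<Rightarrow> real" where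
  "block_start r A w a = sum w {b \<in> A. r b < r a}"

text \<open>Induction by adding the block of largest key: it starts where the others end and leaves
  their starts unchanged.\<close>

lemma block_exists:
  assumes "finite A" "inj_on r A" "\<And>a. a \<in> A \<Longrightarrow> w a > 0" "0 \<le> y" "y < sum w A"
  shows "\<exists>a\<in>A. block_start r A w a \<le> y \<and> y < block_start r A w a + w a"
  using assms
proof (induction A rule: finite_ranking_induct[where f = r])
  case empty
  then show ?case by simp
next
  case (insert x A)
  show ?case
  proof (cases "x \<in> A")
    case True
    then have "insert x A = A" by blast
    then show ?thesis using insert.IH insert.prems by simp
  next
    case x: False
    have lt: "r a < r x" if "a \<in> A" for a
    proof -
      have "r a \<noteq> r x" using insert.prems(1) x that by (auto simp: inj_on_def)
      then show ?thesis using insert.hyps(2)[OF that] by simp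
    qed
    show ?thesis
    proof (cases "y < sum w A")
      case True
      then obtain a where a: "a \<in> A" "block_start r A w a \<le> y" "y < block_start r A w a + w a"
        using insert.IH insert.prems by (auto simp: inj_on_insert)
      have "{b \<in> insert x A. r b < r a} = {b \<in> A. r b < r a}"
        using lt[OF a(1)] by auto
      then have "block_start r (insert x A) w a = block_start r A w a"
        by (simp only: block_start_def)
      then show ?thesis using a by (intro bexI[of _ a]) auto
    next
      case False
      have "{b \<in> insert x A. r b < r x} = A" using lt by auto
      then have "block_start r (insert x A) w x = sum w A" by (simp add: block_start_def)
      moreover have "sum w (insert x A) = sum w A + w x" using insert.hyps x by simp
      ultimately show ?thesis using False insert.prems by auto
    qed
  qed
qed

lemma block_end_le_start:
  assumes "finite A" "\<And>a. a \<in> A \<Longrightarrow> w a > 0" "a \<in> A" "r a < r b"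
  shows "block_start r A w a + w a \<le> block_start r A w b"
proof -
  have "block_start r A w a + w a = sum w (insert a {c \<in> A. r c < r a})"
    using assms by (simp add: block_start_def)
  also have "\<dots> \<le> block_start r A w b"
    unfolding block_start_def using assms by (intro sum_mono2) (auto intro: less_imp_le)
  finally show ?thesis .
qed

lemma block_unique:
  assumes "finite A" "inj_on r A" "\<And>a. a \<in> A \<Longrightarrow> w a > 0" "a \<in> A" "b \<in> A"
    and "block_start r A w a \<le> y" "y < block_start r A w a + w a"
    and "block_start r A w b \<le> y" "y < block_start r A w b + w b"
  shows "a = b"
proof (rule ccontr)
  assume "a \<noteq> b"
  then have "r a < r b \<or> r b < r a" using assms by (meson inj_onD linorder_neqE_nat)
  then show False
    using block_end_le_start[of A w a r b] block_end_le_start[of A w b r a] assms by fastforce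
qed

lemma block_bounds:
  assumes "finite A" "\<And>a. a \<in> A \<Longrightarrow> w a > 0" "a \<in> A"
  shows "0 \<le> block_start r A w a" "block_start r A w a + w a \<le> sum w A"
proof -
  show "0 \<le> block_start r A w a"
    unfolding block_start_def using assms by (intro sum_nonneg) (auto intro: less_imp_le)
  have "block_start r A w a + w a = sum w (insert a {c \<in> A. r c < r a})"
    using assms by (simp add: block_start_def)
  also have "\<dots> \<le> sum w A"
    using assms by (intro sum_mono2) (auto intro: less_imp_le)
  finally show "block_start r A w a + w a \<le> sum w A" .
qed

section \<open>IETs as rearrangements of blocks\<close>

lemma break_pt_eq_block_start:
  assumes "j \<in> {1..m}"
  shows "break_pt l (j - 1) = block_start (\<lambda>i. i) {1..m} l j"
    and "break_pt l j = block_start (\<lambda>i. i) {1..m} l j + l j"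
proof -
  have "{1..j - 1} = {b \<in> {1..m}. b < j}" using assms by auto
  then show 1: "break_pt l (j - 1) = block_start (\<lambda>i. i) {1..m} l j"
    by (simp add: break_pt_def block_start_def)
  obtain k where "j = Suc k" using assms by (cases j) auto
  then show "break_pt l j = block_start (\<lambda>i. i) {1..m} l j + l j"
    using 1 by (simp add: break_pt_def)
qed

lemma iet_interval_eq_block:
  assumes "j \<in> {1..m}"
  shows "iet_interval l j = {block_start (\<lambda>i. i) {1..m} l j..<block_start (\<lambda>i. i) {1..m} l j + l j}"
  unfolding iet_interval_def break_pt_eq_block_start[OF assms] ..

lemma iet_dataD:
  assumes "iet_data m p l"
  shows "\<And>a. a \<in> {1..m} \<Longrightarrow> l a > 0" "sum l {1..m} = 1" "inj_on p {1..m}"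
  using assms by (auto simp: iet_data_def intro: permutes_inj_on)

lemma iet_index_eqI:
  assumes "iet_data m p l" "j \<in> {1..m}" "x \<in> iet_interval l j"
  shows "iet_index m l x = j"
proof -
  have "i = j" if "i \<in> {1..m}" "x \<in> iet_interval l i" for i
    using that assms iet_dataD(1)[OF assms(1)]
      iet_interval_eq_block[OF that(1), of l] iet_interval_eq_block[OF assms(2), of l]
    by (intro block_unique[where A = "{1..m}" and r = "\<lambda>i. i" and w = l and y = x]) auto
  then show ?thesis unfolding iet_index_def using assms(2,3) by (intro the_equality conjI) blast+
qed

lemma iet_index_correct:
  assumes "iet_data m p l" "x \<in> {0..<1}"
  shows "iet_index m l x \<in> {1..m}" "x \<in> iet_interval l (iet_index m l x)"
proof -
  have "\<exists>j\<in>{1..m}. block_start (\<lambda>i. i) {1..m} l j \<le> x \<and> x < block_start (\<lambda>i. i) {1..m} l j + l j"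
    using assms iet_dataD[OF assms(1)] by (intro block_exists) auto
  then obtain j where "j \<in> {1..m}" "x \<in> iet_interval l j"
    using iet_interval_eq_block by force
  then show "iet_index m l x \<in> {1..m}" "x \<in> iet_interval l (iet_index m l x)"
    using iet_index_eqI[OF assms(1)] by auto
qed

lemma iet_interval_subset:
  assumes "iet_data m p l" "j \<in> {1..m}"
  shows "iet_interval l j \<subseteq> {0..<1}"
  using block_bounds[of "{1..m}" l j "\<lambda>i. i"] assms iet_dataD[OF assms(1)]
  unfolding iet_interval_eq_block[OF assms(2)] by auto

lemma iet_map_eq:
  assumes "iet_data m p l" "j \<in> {1..m}" "x \<in> iet_interval l j"
  shows "iet_map m p l x = x - break_pt l (j - 1) + block_start p {1..m} l j"
proof -
  have x: "x \<in> {0..<1}" using iet_interval_subset assms by blast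
  have "iet_index m l x = j" using iet_index_eqI assms by blast
  then show ?thesis
    using x break_pt_eq_block_start(1)[OF assms(2), of l]
    by (simp add: iet_map_def block_start_def Let_def)
qed

lemma iet_map_bij_betw:
  assumes d: "iet_data m p l"
  shows "bij_betw (iet_map m p l) {0..<1} {0..<1}"
proof -
  let ?b = "block_start p {1..m} l"
  have pos: "\<And>a. a \<in> {1..m} \<Longrightarrow> l a > 0" and tot: "sum l {1..m} = 1"
    and inj: "inj_on p {1..m}"
    using iet_dataD[OF d] by auto
  have img: "?b j \<le> iet_map m p l x \<and> iet_map m p l x < ?b j + l j"
    if "j \<in> {1..m}" "x \<in> iet_interval l j" for j x
    using iet_map_eq[OF d that] that
    by (simp add: iet_interval_def break_pt_eq_block_start[OF that(1)] del: One_nat_def)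
  show ?thesis
  proof (rule bij_betwI')
    fix x y :: real
    assume x: "x \<in> {0..<1}" and y: "y \<in> {0..<1}"
    show "(iet_map m p l x = iet_map m p l y) = (x = y)"
    proof
      assume eq: "iet_map m p l x = iet_map m p l y"
      note ix = iet_index_correct[OF d x] and iy = iet_index_correct[OF d y]
      have "iet_index m l x = iet_index m l y"
        using block_unique[OF finite_atLeastAtMost inj pos ix(1) iy(1)] img[OF ix] img[OF iy] eq
        by auto
      then show "x = y"
        using eq unfolding iet_map_eq[OF d ix] iet_map_eq[OF d iy] by simp
    qed simp
  next
    fix x :: real
    assume x: "x \<in> {0..<1}"
    note ix = iet_index_correct[OF d x]
    show "iet_map m p l x \<in> {0..<1}"
      using img[OF ix] block_bounds[of "{1..m}" l "iet_index m l x" p] pos tot ix by auto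
  next
    fix y :: real
    assume "y \<in> {0..<1}"
    then obtain j where j: "j \<in> {1..m}" "?b j \<le> y" "y < ?b j + l j"
      using block_exists[of "{1..m}" p l y] inj pos tot by auto
    let ?x = "break_pt l (j - 1) + (y - ?b j)"
    have x: "?x \<in> iet_interval l j"
      using j by (auto simp: iet_interval_def break_pt_eq_block_start[OF j(1)] simp del: One_nat_def)
    then have "y = iet_map m p l ?x" using iet_map_eq[OF d j(1) x] by simp
    then show "\<exists>x\<in>{0..<1}. y = iet_map m p l x"
      using iet_interval_subset[OF d j(1)] x by blast
  qed
qed

lemma iet_map_piecewise_translation:
  assumes d: "iet_data m p l"
  shows "piecewise_translation ((\<lambda>j. break_pt l (j - 1)) ` {1..m}) (iet_map m p l)"
  unfolding piecewise_translation_def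
proof (intro conjI allI impI)
  fix x y :: real
  let ?F = "(\<lambda>j. break_pt l (j - 1)) ` {1..m}"
  assume a: "0 \<le> x" "x < y" "y < 1" "{x<..y} \<inter> ?F = {}"
  let ?j = "iet_index m l y"
  have j: "?j \<in> {1..m}" "y \<in> iet_interval l ?j"
    using iet_index_correct[OF d, of y] a by auto
  then have "break_pt l (?j - 1) \<notin> {x<..y}" using a by blast
  then have x: "x \<in> iet_interval l ?j" using a j by (auto simp: iet_interval_def)
  show "iet_map m p l y - y = iet_map m p l x - x"
    unfolding iet_map_eq[OF d j] iet_map_eq[OF d j(1) x] by simp
qed simp

section \<open>Recognising IETs\<close>

text \<open>Finite additivity of Lebesgue measure replaces any sorting of the pieces. It serves both
  to locate the image pieces of an IET and to add up the levels of a tower.\<close>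

lemma sum_lengths_of_partition:
  fixes e w :: "'a \<Rightarrow> real"
  assumes "finite A" "\<And>a. a \<in> A \<Longrightarrow> 0 \<le> w a" "u \<le> v"
    and "(\<Union>a\<in>A. {e a..<e a + w a}) = {u..<v}"
    and "disjoint_family_on (\<lambda>a. {e a..<e a + w a}) A"
  shows "sum w A = v - u"
proof -
  have "measure lborel (\<Union>a\<in>A. {e a..<e a + w a}) = (\<Sum>a\<in>A. measure lborel {e a..<e a + w a})"
    using assms by (intro measure_finite_Union) auto
  also have "\<dots> = sum w A" using assms by (intro sum.cong) auto
  finally show ?thesis using assms by simp
qed

text \<open>The breaks, with 0 adjoined, cut \<open>[0,1)\<close> into pieces, and \<open>p\<close>
  ranks the pieces by their images. As the images tile \<open>[0,1)\<close>, each begins at the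
  total length of those of smaller rank, which is the formula defining an IET.\<close>

lemma iet_of_piecewise_translation:
  assumes ext: "f \<in> extensional {0..<1}" and bij: "bij_betw f {0..<1} {0..<1}"
    and pt: "piecewise_translation F f"
  shows "f \<in> IETs"
proof -
  define B where "B = insert 0 (F \<inter> {0..<1})"
  define m where "m = card B"
  \<comment> \<open>The sentinel \<open>b (Suc m) = 1\<close> closes the last piece, so that the
    lengths \<open>l\<close> telescope.\<close>
  define b where "b j = (if j = Suc m then 1 else sorted_list_of_set B ! (j - 1))" for j
  define l where "l j = b (Suc j) - b j" for j
  \<comment> \<open>The rank of the left end of the image piece; outside \<open>{1..m}\<close> the
    identity, as \<open>permutes\<close> demands.\<close>
  define p where "p j = (if j \<in> {1..m} then card {i \<in> {1..m}. f (b i) \<le> f (b j)} else j)" for j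
  have fin: "finite B" using pt by (simp add: B_def piecewise_translation_def)
  have m1: "m \<ge> 1" using fin by (auto simp: m_def B_def Suc_le_eq card_gt_0_iff)
  have len: "length (sorted_list_of_set B) = m" by (simp add: m_def)
  have bB: "b j \<in> B" if "j \<in> {1..m}" for j
  proof -
    have "sorted_list_of_set B ! (j - 1) \<in> set (sorted_list_of_set B)"
      using that len by (intro nth_mem) auto
    then show ?thesis using that fin by (auto simp: b_def)
  qed
  have b01: "b j \<in> {0..<1}" if "j \<in> {1..m}" for j
    using bB[OF that] by (auto simp: B_def)
  have b_mono: "b i < b j" if "i \<in> {1..m}" "j \<in> {1..Suc m}" "i < j" for i j
  proof (cases "j = Suc m")
    case True
    then show ?thesis using b01[OF that(1)] by (simp add: b_def)
  next
    case False
    have "sorted_list_of_set B ! (i - 1) < sorted_list_of_set B ! (j - 1)"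
      using that len False
      by (intro sorted_wrt_nth_less[OF strict_sorted_list_of_set]) auto
    then show ?thesis using that False by (simp add: b_def)
  qed
  have Bb: "\<exists>j\<in>{1..m}. x = b j" if "x \<in> B" for x
  proof -
    have "x \<in> set (sorted_list_of_set B)" using fin that by simp
    then obtain i where "i < m" "sorted_list_of_set B ! i = x"
      using len by (metis in_set_conv_nth)
    then show ?thesis by (intro bexI[of _ "Suc i"]) (auto simp: b_def)
  qed
  have b1: "b 1 = 0"
  proof -
    obtain j where j: "j \<in> {1..m}" "0 = b j" using Bb[of 0] by (auto simp: B_def)
    show ?thesis
    proof (cases "j = 1")
      case False
      then have "b 1 < b j" using j m1 by (intro b_mono) auto
      then show ?thesis using b01[of 1] j m1 by simp
    qed (use j in simp)
  qed
  have brk: "break_pt l j = b (Suc j)" for j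
  proof -
    have "(\<Sum>i = 1..j. l i) = b (Suc j) - b 1"
      unfolding l_def by (rule sum_Suc_diff) simp
    then show ?thesis using b1 by (simp add: break_pt_def)
  qed
  have lpos: "l j > 0" if "j \<in> {1..m}" for j
    using b_mono[of j "Suc j"] that by (auto simp: l_def)
  have int: "iet_interval l j = {b j..<b j + l j}" if "j \<in> {1..m}" for j
    using that by (auto simp: iet_interval_def brk l_def)
  have finj: "inj_on (\<lambda>j. f (b j)) {1..m}"
  proof (rule inj_onI)
    fix i j assume ij: "i \<in> {1..m}" "j \<in> {1..m}" "f (b i) = f (b j)"
    then have "b i = b j" using bij b01 by (meson bij_betw_imp_inj_on inj_onD)
    then show "i = j" using b_mono[of i j] b_mono[of j i] ij by (cases i j rule: linorder_cases) auto
  qed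
  have pmono: "p i < p j" if "i \<in> {1..m}" "j \<in> {1..m}" "f (b i) < f (b j)" for i j
  proof -
    have "{k \<in> {1..m}. f (b k) \<le> f (b i)} \<subset> {k \<in> {1..m}. f (b k) \<le> f (b j)}"
      using that by (intro psubsetI) (auto simp: set_eq_iff intro!: exI[of _ j])
    then show ?thesis using that by (simp add: p_def psubset_card_mono)
  qed
  have piff: "p i < p j \<longleftrightarrow> f (b i) < f (b j)" if "i \<in> {1..m}" "j \<in> {1..m}" for i j
  proof (cases "i = j")
    case False
    then have "f (b i) \<noteq> f (b j)" using finj that by (auto dest: inj_onD)
    then show ?thesis using pmono[OF that] pmono[OF that(2,1)] by force
  qed simp
  have pinj: "inj_on p {1..m}"
  proof (rule inj_onI)
    fix i j assume ij: "i \<in> {1..m}" "j \<in> {1..m}" "p i = p j"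
    then have "f (b i) = f (b j)" using piff[of i j] piff[of j i] by auto
    then show "i = j" using finj ij by (auto dest: inj_onD)
  qed
  have "p ` {1..m} \<subseteq> {1..m}"
  proof
    fix k assume "k \<in> p ` {1..m}"
    then obtain j where j: "j \<in> {1..m}" "k = card {i \<in> {1..m}. f (b i) \<le> f (b j)}"
      by (auto simp: p_def)
    have "card {i \<in> {1..m}. f (b i) \<le> f (b j)} \<le> card {1..m}" by (intro card_mono) auto
    moreover have "card {i \<in> {1..m}. f (b i) \<le> f (b j)} > 0"
      using j by (auto simp: card_gt_0_iff)
    ultimately show "k \<in> {1..m}" using j by simp
  qed
  then have "bij_betw p {1..m} {1..m}"
    using pinj by (simp add: bij_betw_def endo_inj_surj)
  then have perm: "p permutes {1..m}" by (intro bij_imp_permutes) (auto simp: p_def)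
  have tot: "sum l {1..m} = 1"
    using brk[of m] by (simp add: break_pt_def b_def)
  have data: "iet_data m p l" using m1 perm lpos tot by (simp add: iet_data_def)
  have ftr: "f x = f (b j) + (x - b j)" if "j \<in> {1..m}" "x \<in> iet_interval l j" for j x
  proof -
    have x: "b j \<le> x" "x < b (Suc j)" "x < 1"
      using that iet_interval_subset[OF data that(1)] by (auto simp: int l_def)
    have "y \<notin> F" if y: "y \<in> {b j<..x}" for y
    proof
      assume "y \<in> F"
      then have "y \<in> B" using y x b01[OF \<open>j \<in> {1..m}\<close>] by (auto simp: B_def)
      then obtain i where i: "i \<in> {1..m}" "y = b i" using Bb by blast
      have "j < i"
        using b_mono[of i j] i y \<open>j \<in> {1..m}\<close> by (cases i j rule: linorder_cases) auto
      then have "b (Suc j) \<le> b i"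
        using b_mono[of "Suc j" i] i by (cases "Suc j = i") auto
      then show False using y i x by auto
    qed
    then have "f x - x = f (b j) - b j"
      using x b01[OF that(1)] by (intro piecewise_translationD[OF pt]) auto
    then show ?thesis by simp
  qed
  have start: "f (b j) = block_start p {1..m} l j" if j: "j \<in> {1..m}" for j
  proof -
    let ?A = "{i \<in> {1..m}. p i < p j}"
    have img: "{f (b i)..<f (b i) + l i} = f ` iet_interval l i" if "i \<in> {1..m}" for i
    proof -
      have "f ` iet_interval l i = (\<lambda>x. (f (b i) - b i) + x) ` {b i..<b i + l i}"
        unfolding int[OF that, symmetric] by (intro image_cong refl) (use ftr[OF that] in simp)
      also have "\<dots> = {b i + (f (b i) - b i)..<b i + l i + (f (b i) - b i)}"
        by (rule image_add_atLeastLessThan)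
      finally show ?thesis by (simp add: algebra_simps)
    qed
    have f01: "f x \<in> {0..<1}" if "x \<in> {0..<1}" for x
      using bij that by (rule bij_betwE[rule_format])
    have eqI: "i = k" if ik: "i \<in> {1..m}" "k \<in> {1..m}" "y \<in> f ` iet_interval l i" "y \<in> f ` iet_interval l k"
      for i k y
    proof -
      obtain x z where xz: "x \<in> iet_interval l i" "z \<in> iet_interval l k" "y = f x" "y = f z"
        using ik(3,4) by blast
      have "x \<in> {0..<1}" "z \<in> {0..<1}"
        using iet_interval_subset[OF data] ik(1,2) xz(1,2) by blast+
      then have "x = z"
        using inj_onD[OF bij_betw_imp_inj_on[OF bij], of x z] xz(3,4) by simp
      then show ?thesis
        using iet_index_eqI[OF data ik(1) xz(1)] iet_index_eqI[OF data ik(2) xz(2)] by simp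
    qed
    have "sum l ?A = f (b j) - 0"
    proof (rule sum_lengths_of_partition[where e = "\<lambda>i. f (b i)"])
      show "0 \<le> f (b j)" using f01[OF b01[OF j]] by simp
      show "disjoint_family_on (\<lambda>i. {f (b i)..<f (b i) + l i}) ?A"
        using eqI img by (auto simp: disjoint_family_on_def)
      show "(\<Union>i\<in>?A. {f (b i)..<f (b i) + l i}) = {0..<f (b j)}"
      proof (intro equalityI subsetI)
        fix y assume "y \<in> (\<Union>i\<in>?A. {f (b i)..<f (b i) + l i})"
        then obtain i where i: "i \<in> {1..m}" "p i < p j" "y \<in> {f (b i)..<f (b i) + l i}" by auto
        \<comment> \<open>An image piece that begins left of \<open>f (b j)\<close> must also end
          there, since otherwise it would contain the start of the image of piece
          \<open>j\<close>.\<close>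
        have "f (b j) \<notin> {f (b i)..<f (b i) + l i}"
          using eqI[OF i(1) j, of "f (b j)"] img[OF i(1)] i j int[OF j] lpos[OF j] by auto
        then show "y \<in> {0..<f (b j)}"
          using i piff[OF i(1) j] f01[OF b01[OF i(1)]] by auto
      next
        fix y assume y: "y \<in> {0..<f (b j)}"
        then have "y \<in> f ` {0..<1}"
          using bij f01[OF b01[OF j]] by (simp add: bij_betw_def)
        then obtain x where x: "x \<in> {0..<1}" "y = f x" by blast
        define i where "i = iet_index m l x"
        have i: "i \<in> {1..m}" "x \<in> iet_interval l i"
          using iet_index_correct[OF data x(1)] by (auto simp: i_def)
        then have yi: "y \<in> {f (b i)..<f (b i) + l i}" using img x by blast
        then have "p i < p j" using y piff[OF i(1) j] by auto
        then show "y \<in> (\<Union>i\<in>?A. {f (b i)..<f (b i) + l i})" using yi i by blast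
      qed
    qed (use lpos in \<open>auto intro: less_imp_le\<close>)
    then show ?thesis by (simp add: block_start_def)
  qed
  have "f = iet_map m p l"
  proof
    fix x
    show "f x = iet_map m p l x"
    proof (cases "x \<in> {0..<1}")
      case True
      note ix = iet_index_correct[OF data True]
      show ?thesis
        using ftr[OF ix] iet_map_eq[OF data ix] start[OF ix(1)] ix(1) brk[of "iet_index m l x - 1"]
        by simp
    qed (use ext in \<open>auto simp: iet_map_def extensional_def\<close>)
  qed
  then show ?thesis using data by (auto simp: IETs_def)
qed

text \<open>Trades the permutation and the lengths for a condition that is easily followed through
  composition, inversion and iteration.\<close>

lemma IETs_iff:
  "f \<in> IETs \<longleftrightarrow> f \<in> extensional {0..<1} \<and> bij_betw f {0..<1} {0..<1} \<and>
     (\<exists>F. piecewise_translation F f)"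
proof
  assume "f \<in> IETs"
  then obtain m p l where d: "iet_data m p l" and f: "f = iet_map m p l" by (auto simp: IETs_def)
  have "f \<in> extensional {0..<1}" by (auto simp: f iet_map_def)
  then show "f \<in> extensional {0..<1} \<and> bij_betw f {0..<1} {0..<1} \<and>
      (\<exists>F. piecewise_translation F f)"
    using iet_map_bij_betw[OF d] iet_map_piecewise_translation[OF d] unfolding f
    by (intro conjI exI)
qed (elim conjE exE, rule iet_of_piecewise_translation)

section \<open>Composition and inversion of IETs\<close>

lemma iet_compose:
  assumes "f \<in> IETs" "g \<in> IETs"
  shows "compose {0..<1} g f \<in> IETs"
proof -
  obtain F G where F: "piecewise_translation F f" and G: "piecewise_translation G g"
    using assms IETs_iff by blast
  have bf: "bij_betw f {0..<1} {0..<1}" and bg: "bij_betw g {0..<1} {0..<1}"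
    using assms IETs_iff by auto
  \<comment> \<open>The composite can break where \<open>f\<close> does or where \<open>f\<close>
    lands on a break of \<open>g\<close>; injectivity of \<open>f\<close> keeps the second set
    finite.\<close>
  let ?H = "F \<union> ({0..<1} \<inter> f -` G)"
  have "piecewise_translation ?H (compose {0..<1} g f)"
    unfolding piecewise_translation_def
  proof (intro conjI allI impI)
    have "finite ({0..<1} \<inter> f -` G)"
      using finite_vimage_IntI[of G f "{0..<1}"] G bf
      by (auto simp: piecewise_translation_def bij_betw_def Int_commute)
    then show "finite ?H" using F by (simp add: piecewise_translation_def)
  next
    fix x y :: real
    assume a: "0 \<le> x" "x < y" "y < 1" "{x<..y} \<inter> ?H = {}"
    have tr: "f z = f x + (z - x)" if "x \<le> z" "z \<le> y" for z
      using piecewise_translationD[OF F, of x z] a that by force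
    have "g (f y) - f y = g (f x) - f x"
    proof (rule piecewise_translationD[OF G])
      show "0 \<le> f x" "f y < 1" using bij_betwE[OF bf] a by auto
      show "f x \<le> f y" using tr[of y] a by simp
      show "{f x<..f y} \<inter> G = {}"
      proof (rule ccontr)
        assume "{f x<..f y} \<inter> G \<noteq> {}"
        then obtain u where u: "u \<in> G" "f x < u" "u \<le> f y" by auto
        \<comment> \<open>The preimage of \<open>u\<close>, as \<open>f\<close> is a translation
          between \<open>x\<close> and \<open>y\<close>.\<close>
        let ?z = "x + (u - f x)"
        have z: "x < ?z" "?z \<le> y" using u tr[of y] a by auto
        then have "f ?z = u" using tr[of ?z] by simp
        then have "?z \<in> {x<..y} \<inter> ?H"
          using z u a by (intro IntI UnI2 vimageI2) auto
        then show False using a by blast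
      qed
    qed
    then show "compose {0..<1} g f y - y = compose {0..<1} g f x - x"
      using tr[of y] a by (simp add: compose_def)
  qed
  moreover have "bij_betw (compose {0..<1} g f) {0..<1} {0..<1}"
    using bf bg by (rule bij_betw_compose)
  moreover have "compose {0..<1} g f \<in> extensional {0..<1}"
    by (rule compose_extensional)
  ultimately show ?thesis
    by (intro iet_of_piecewise_translation)
qed

text \<open>The pieces of the inverse begin at the images of the left ends of the pieces of
  \<open>f\<close>. The point 0 is such a left end even when \<open>F\<close> omits it.\<close>

lemma iet_inverse:
  assumes "f \<in> IETs"
  shows "restrict (inv_into {0..<1} f) {0..<1} \<in> IETs"
proof -
  obtain F where F: "piecewise_translation F f" using assms IETs_iff by blast
  have bf: "bij_betw f {0..<1} {0..<1}" using assms IETs_iff by auto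
  let ?g = "restrict (inv_into {0..<1} f) {0..<1}"
  let ?B = "insert 0 (F \<inter> {0..<1})"
  have fin: "finite ?B" using F by (simp add: piecewise_translation_def)
  have gf: "inv_into {0..<1} f (f x) = x" if "x \<in> {0..<1}" for x
    using bij_betw_inv_into_left[OF bf that] .
  have "piecewise_translation (f ` ?B) ?g"
    unfolding piecewise_translation_def
  proof (intro conjI allI impI)
    show "finite (f ` ?B)" using fin by simp
    fix u v :: real
    assume a: "0 \<le> u" "u < v" "v < 1" "{u<..v} \<inter> f ` ?B = {}"
    obtain y where y: "y \<in> {0..<1}" "f y = v"
    proof -
      have "v \<in> f ` {0..<1}" using bf a by (simp add: bij_betw_def)
      then show ?thesis using that by blast
    qed
    define c where "c = Max {b \<in> ?B. b \<le> y}"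
    have ne: "0 \<in> {b \<in> ?B. b \<le> y}" using y by simp
    have fin': "finite {b \<in> ?B. b \<le> y}" using fin by (rule finite_subset[rotated]) auto
    have "c \<in> {b \<in> ?B. b \<le> y}" unfolding c_def by (rule Max_in[OF fin']) (use ne in blast)
    then have c: "c \<in> ?B" "c \<le> y" "0 \<le> c" by auto
    have cmax: "b \<le> c" if "b \<in> ?B" "b \<le> y" for b
      unfolding c_def by (rule Max_ge[OF fin']) (use that in blast)
    have tr: "f z = f c + (z - c)" if "c \<le> z" "z \<le> y" for z
    proof -
      have "{c<..z} \<inter> F = {}" using cmax that y c by force
      then show ?thesis using piecewise_translationD[OF F, of c z] that y c by auto
    qed
    \<comment> \<open>\<open>c\<close> is the left end of the piece of \<open>y\<close>. Its image
      is a break of the inverse, hence is not passed between \<open>u\<close> and \<open>v\<close>,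
      and the preimage of \<open>u\<close> lies in the same piece.\<close>
    have "f c \<notin> {u<..v}" using a c by blast
    then have fc: "f c \<le> u" using tr[of y] y c by auto
    let ?x = "c + (u - f c)"
    have x: "c \<le> ?x" "?x \<le> y" using fc a tr[of y] y c by auto
    then have fx: "f ?x = u" using tr[of ?x] by simp
    have "inv_into {0..<1} f u = ?x" using gf[of ?x] fx x c y by auto
    moreover have "inv_into {0..<1} f v = y" using gf[of y] y by simp
    ultimately show "?g v - v = ?g u - u" using a tr[of y] y c by auto
  qed
  moreover have "bij_betw ?g {0..<1} {0..<1}"
    using bij_betw_inv_into[OF bf] by (simp add: bij_betw_def inj_on_def)
  ultimately show ?thesis
    by (intro iet_of_piecewise_translation[OF restrict_extensional])
qed

section \<open>Orbits and minimality\<close>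

text \<open>The displacement \<open>f t - t\<close> is constant just left of \<open>z\<close> and
  constant from \<open>z\<close> on; continuity at \<open>z\<close> forces the two constants to
  agree.\<close>

lemma piecewise_translation_remove:
  assumes pt: "piecewise_translation F f" and cont: "continuous (at z within {0..<1}) f"
  shows "piecewise_translation (F - {z}) f"
  unfolding piecewise_translation_def
proof (intro conjI allI impI)
  show "finite (F - {z})" using pt by (simp add: piecewise_translation_def)
  fix x y :: real
  assume a: "0 \<le> x" "x < y" "y < 1" "{x<..y} \<inter> (F - {z}) = {}"
  show "f y - y = f x - x"
  proof (cases "z \<in> {x<..y}")
    case False
    then have "{x<..y} \<inter> F = {}" using a by blast
    then show ?thesis using a by (intro piecewise_translationD[OF pt]) auto
  next
    case True
    have left: "f t - t = f x - x" if "x \<le> t" "t < z" for t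
    proof (rule piecewise_translationD[OF pt])
      show "{x<..t} \<inter> F = {}" using that True a by force
    qed (use that True a in auto)
    have right: "f y - y = f z - z"
    proof (rule piecewise_translationD[OF pt])
      have "w \<in> {x<..y} \<inter> (F - {z})" if "w \<in> {z<..y} \<inter> F" for w
        using that True by auto
      then show "{z<..y} \<inter> F = {}" using a by blast
    qed (use True a in auto)
    have "f z - z = f x - x"
    proof (rule ccontr)
      \<comment> \<open>Half the jump of the displacement: at a point \<open>t\<close> near
        \<open>z\<close>, both \<open>f z - f t\<close> and \<open>z - t\<close> are smaller than
        \<open>e\<close> in absolute value, so the jump would be smaller than
        \<open>2 * e\<close>.\<close>
      define e where "e = \<bar>f z - z - (f x - x)\<bar> / 2"
      assume "f z - z \<noteq> f x - x"
      then have e: "e > 0" by (simp add: e_def)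
      then obtain d where d: "d > 0" "\<And>t. t \<in> {0..<1} \<Longrightarrow> dist t z < d \<Longrightarrow> dist (f t) (f z) < e"
        using cont unfolding continuous_within_eps_delta by blast
      define t where "t = max x (z - min d e / 2)"
      have t: "x \<le> t" "t < z" "t \<in> {0..<1}" "\<bar>t - z\<bar> < d" "\<bar>t - z\<bar> < e"
        using d(1) e True a by (auto simp: t_def)
      then have "\<bar>f t - f z\<bar> < e" using d(2)[of t] by (simp add: dist_real_def)
      then show False using left[OF t(1,2)] t(5) by (simp add: e_def abs_if split: if_splits)
    qed
    then show ?thesis using right by simp
  qed
qed

text \<open>Makes every remaining break a genuine discontinuity, so that the hypothesis on orbits
  applies to all of them.\<close>

lemma piecewise_translation_discontinuities:
  assumes "piecewise_translation F f"
  shows "piecewise_translation (F \<inter> discontinuities f) f"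
proof -
  let ?C = "(F - discontinuities f) \<inter> {0..<1}"
  have *: "piecewise_translation (F - C) f" if "finite C" "C \<subseteq> ?C" for C
    using that
  proof (induction C rule: finite_induct)
    case empty
    then show ?case using assms by simp
  next
    case (insert z C)
    then have "continuous (at z within {0..<1}) f" by (auto simp: discontinuities_def)
    then have "piecewise_translation ((F - C) - {z}) f"
      using insert by (intro piecewise_translation_remove) auto
    moreover have "(F - C) - {z} = F - insert z C" by auto
    ultimately show ?case by simp
  qed
  have "finite ?C" using assms by (simp add: piecewise_translation_def)
  note * = *[OF this subset_refl]
  have "f y - y = f x - x" if "0 \<le> x" "x < y" "y < 1" "{x<..y} \<inter> (F \<inter> discontinuities f) = {}" for x y
  proof (rule piecewise_translationD[OF *])
    show "{x<..y} \<inter> (F - ?C) = {}" using that by force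
  qed (use that in auto)
  moreover have "finite (F \<inter> discontinuities f)"
    using assms by (simp add: piecewise_translation_def)
  ultimately show ?thesis unfolding piecewise_translation_def by blast
qed

lemma funpow_in_unit:
  assumes "bij_betw T S S" "x \<in> S"
  shows "(T ^^ n) x \<in> S"
  using bij_betw_funpow[OF assms(1), of n] assms(2) by (auto dest: bij_betwE)

lemma funpow_cancel:
  assumes "bij_betw T S S" "x \<in> S" "y \<in> S" "(T ^^ n) x = (T ^^ n) y"
  shows "x = y"
  using bij_betw_funpow[OF assms(1), of n] assms(2-) by (meson bij_betw_imp_inj_on inj_onD)

section \<open>Orbits in terms of forward iterates\<close>

lemma carrier_BijGroup: "carrier (BijGroup S) = Bij S"
  by (simp add: BijGroup_def)

lemma mult_BijGroup: "g \<in> Bij S \<Longrightarrow> f \<in> Bij S \<Longrightarrow> g \<otimes>\<^bsub>BijGroup S\<^esub> f = compose S g f"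
  by (simp add: BijGroup_def)

lemma one_BijGroup: "\<one>\<^bsub>BijGroup S\<^esub> = (\<lambda>x\<in>S. x)"
  by (simp add: BijGroup_def)

lemma pow_BijGroup_closed: "T \<in> Bij S \<Longrightarrow> T [^]\<^bsub>BijGroup S\<^esub> (n :: nat) \<in> Bij S"
  using monoid.nat_pow_closed[OF group.is_monoid[OF group_BijGroup], of T S n]
  by (simp only: carrier_BijGroup)

lemma pow_BijGroup_apply:
  assumes "T \<in> Bij S" "x \<in> S"
  shows "(T [^]\<^bsub>BijGroup S\<^esub> (n :: nat)) x = (T ^^ n) x"
  using assms(2)
proof (induction n arbitrary: x)
  case 0
  then show ?case by (simp add: one_BijGroup)
next
  case (Suc n)
  have "(T [^]\<^bsub>BijGroup S\<^esub> Suc n) x = (T [^]\<^bsub>BijGroup S\<^esub> n) (T x)"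
    using Suc.prems
    by (simp add: mult_BijGroup[OF pow_BijGroup_closed[OF assms(1)] assms(1)] compose_def)
  moreover have "T x \<in> S" using assms Suc.prems by (auto simp: Bij_def bij_betw_def)
  ultimately show ?case using Suc.IH by (simp add: funpow_swap1)
qed

lemma int_pow_BijGroup_apply:
  assumes "T \<in> Bij S" "x \<in> S"
  shows "(T [^]\<^bsub>BijGroup S\<^esub> (int n)) x = (T ^^ n) x"
    and "(T [^]\<^bsub>BijGroup S\<^esub> (- int n)) x = inv_into S (T ^^ n) x"
proof -
  show "(T [^]\<^bsub>BijGroup S\<^esub> (int n)) x = (T ^^ n) x"
    unfolding int_pow_int by (rule pow_BijGroup_apply[OF assms])
  have "T [^]\<^bsub>BijGroup S\<^esub> (- int n) = inv\<^bsub>BijGroup S\<^esub> (T [^]\<^bsub>BijGroup S\<^esub> n)"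
    using group.int_pow_neg_int[OF group_BijGroup] assms(1) by (simp only: carrier_BijGroup)
  then have "(T [^]\<^bsub>BijGroup S\<^esub> (- int n)) x = inv_into S (T [^]\<^bsub>BijGroup S\<^esub> n) x"
    using inv_BijGroup[OF pow_BijGroup_closed[OF assms(1)]] assms(2) by simp
  also have "\<dots> = inv_into S (T ^^ n) x"
    unfolding inv_into_def using pow_BijGroup_apply[OF assms(1)]
    by (intro arg_cong[where f = Eps] ext) auto
  finally show "(T [^]\<^bsub>BijGroup S\<^esub> (- int n)) x = inv_into S (T ^^ n) x" .
qed

text \<open>Integer powers in the group become natural iterates applied at one of the two ends, so
  that orbit arguments follow points forward only.\<close>

lemma iet_orbit_iff:
  assumes T: "T \<in> IETs" and x: "x \<in> {0..<1}"
  shows "y \<in> iet_orbit T x \<longleftrightarrow> y \<in> {0..<1} \<and> (\<exists>n. y = (T ^^ n) x \<or> x = (T ^^ n) y)"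
proof -
  have b: "bij_betw T {0..<1} {0..<1}" and B: "T \<in> Bij {0..<1}"
    using T IETs_iff by (auto simp: Bij_def)
  have bn: "bij_betw (T ^^ n) {0..<1} {0..<1}" for n by (rule bij_betw_funpow[OF b])
  have inv: "z = inv_into {0..<1} (T ^^ n) x \<longleftrightarrow> z \<in> {0..<1} \<and> x = (T ^^ n) z" for z n
    using bij_betw_inv_into_left[OF bn] bij_betw_inv_into_right[OF bn x]
      bij_betwE[OF bij_betw_inv_into[OF bn]] x by metis
  have "y \<in> iet_orbit T x \<longleftrightarrow> (\<exists>n. y = (T [^]\<^bsub>BijGroup {0..<1}\<^esub> (n :: int)) x)"
    by (simp add: iet_orbit_def)
  also have "\<dots> \<longleftrightarrow> (\<exists>n. y = (T ^^ n) x \<or> y = inv_into {0..<1} (T ^^ n) x)"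
    by (metis int_cases2 int_pow_BijGroup_apply[OF B x])
  also have "\<dots> \<longleftrightarrow> y \<in> {0..<1} \<and> (\<exists>n. y = (T ^^ n) x \<or> x = (T ^^ n) y)"
    using inv funpow_in_unit[OF b x] by metis
  finally show ?thesis .
qed

lemma minimal_orbit_meets:
  assumes "minimal_iet T" "x \<in> {0..<1}" "0 \<le> u" "u < v" "v \<le> 1"
  shows "\<exists>y. u < y \<and> y < v \<and> y \<in> iet_orbit T x"
proof -
  have "{0..<1} \<subseteq> closure (iet_orbit T x)"
    using assms(1,2) unfolding minimal_iet_def by blast
  moreover have "(u + v) / 2 \<in> {0..<1}" using assms by auto
  ultimately have "(u + v) / 2 \<in> closure (iet_orbit T x)" by blast
  moreover have "(u + v) / 2 \<in> {u<..<v}" using assms by auto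
  ultimately have "{u<..<v} \<inter> iet_orbit T x \<noteq> {}"
    using open_Int_closure_eq_empty[of "{u<..<v}" "iet_orbit T x"]
      open_greaterThanLessThan[of u v] by blast
  then show ?thesis by auto
qed

text \<open>The two-sided orbit of a periodic point is finite, hence closed, and cannot be
  dense.\<close>

lemma minimal_not_periodic:
  assumes "minimal_iet T" "x \<in> {0..<1}" "n \<ge> 1"
  shows "(T ^^ n) x \<noteq> x"
proof
  assume per: "(T ^^ n) x = x"
  have T: "T \<in> IETs" using assms by (simp add: minimal_iet_def)
  then have b: "bij_betw T {0..<1} {0..<1}" using IETs_iff by blast
  have "iet_orbit T x \<subseteq> (\<lambda>i. (T ^^ i) x) ` {..<n}"
  proof
    fix y assume "y \<in> iet_orbit T x"
    then obtain k where y: "y \<in> {0..<1}" and k: "y = (T ^^ k) x \<or> x = (T ^^ k) y"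
      using iet_orbit_iff[OF T assms(2)] by blast
    have "\<exists>k. y = (T ^^ k) x"
    proof (cases "y = (T ^^ k) x")
      case False
      then have x: "x = (T ^^ k) y" using k by simp
      \<comment> \<open>A point \<open>k\<close> steps behind \<open>x\<close> is also ahead of it:
        \<open>n * k\<close> steps are whole periods, so \<open>n * k - k\<close> steps from
        \<open>x\<close> lead to that point.\<close>
      have "k \<le> n * k" using assms(3) by simp
      then have "(T ^^ k) ((T ^^ (n * k - k)) x) = (T ^^ (n * k)) x"
        by (metis comp_apply funpow_add le_add_diff_inverse)
      also have "\<dots> = (T ^^ (n * k mod n)) x" using funpow_mod_eq[OF per] by metis
      also have "\<dots> = (T ^^ k) y" using x by simp
      finally have "(T ^^ (n * k - k)) x = y"
        using funpow_cancel[OF b funpow_in_unit[OF b assms(2)] y] by blast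
      then show ?thesis by blast
    qed blast
    then obtain k where "y = (T ^^ k) x" by blast
    then have "y = (T ^^ (k mod n)) x" using funpow_mod_eq[OF per] by metis
    then show "y \<in> (\<lambda>i. (T ^^ i) x) ` {..<n}" using assms(3) by (intro image_eqI[of _ _ "k mod n"]) auto
  qed
  then have fin: "finite (iet_orbit T x)" by (rule finite_subset) simp
  then have "{0..<1} \<subseteq> iet_orbit T x"
    using assms(1,2) closure_closed[OF finite_imp_closed[OF fin]] unfolding minimal_iet_def
    by blast
  then have "finite {0..<1::real}" using fin finite_subset by blast
  then show False using infinite_Ico[of "0::real" 1] by simp
qed

section \<open>The first return map\<close>

lemma funpow_add_apply: "(f ^^ m) ((f ^^ n) x) = (f ^^ (m + n)) x"
  by (simp add: funpow_add)

text \<open>As long as no interior point meets a break or \<open>a\<close>, the interval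
  \<open>[u,v)\<close> travels as a rigid block which lies entirely on one side of \<open>a\<close>,
  so all its points return at the same time. It does return, because its translates would otherwise
  be disjoint and of equal length inside \<open>[0,1)\<close>. Only points \<open>y > u\<close> are
  restricted: a break at the left end of a block does not split it.\<close>

lemma first_return:
  assumes bij: "bij_betw T {0..<1} {0..<1}" and pt: "piecewise_translation D T"
    and uv: "0 \<le> a" "a \<le> u" "u < v" "v \<le> (1::real)"
    and good: "\<forall>y n. u < y \<longrightarrow> y < v \<longrightarrow> (\<forall>i. 1 \<le> i \<longrightarrow> i < n \<longrightarrow> (T ^^ i) y < a) \<longrightarrow>
      (T ^^ n) y \<notin> insert a D"
  shows "\<exists>n\<ge>1. (\<forall>i x. i \<le> n \<longrightarrow> u \<le> x \<longrightarrow> x < v \<longrightarrow> (T ^^ i) x = (T ^^ i) u + (x - u)) \<and>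
    (\<forall>i x. 1 \<le> i \<longrightarrow> i < n \<longrightarrow> u \<le> x \<longrightarrow> x < v \<longrightarrow> (T ^^ i) x < a) \<and>
    (\<forall>x. u \<le> x \<longrightarrow> x < v \<longrightarrow> a \<le> (T ^^ n) x)" (is "\<exists>n\<ge>1. ?R n")
proof (rule ccontr)
  assume neg: "\<not> ?thesis"
  define trans where "trans n \<longleftrightarrow> (\<forall>i\<le>n. \<forall>x. u \<le> x \<and> x < v \<longrightarrow> (T ^^ i) x = (T ^^ i) u + (x - u))" for n
  define away where "away n \<longleftrightarrow> (\<forall>i x. 1 \<le> i \<and> i \<le> n \<and> u \<le> x \<and> x < v \<longrightarrow> (T ^^ i) x < a)" for n
  have in01: "(T ^^ n) x \<in> {0..<1}" if "u \<le> x" "x < v" for n x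
    using that uv by (intro funpow_in_unit[OF bij]) auto
  have "trans n \<and> away n" for n
  proof (induction n)
    case 0
    then show ?case by (simp add: trans_def away_def)
  next
    case (Suc n)
    have lt: "(T ^^ i) y < a" if "1 \<le> i" "i < Suc n" "u \<le> y" "y < v" for i y
      using Suc.IH that less_Suc_eq_le[of i n] unfolding away_def by blast
    have tr: "(T ^^ n) x = (T ^^ n) u + (x - u)" if "u \<le> x" "x < v" for x
      using Suc.IH that unfolding trans_def by blast
    have away: "\<forall>i. 1 \<le> i \<longrightarrow> i < k \<longrightarrow> (T ^^ i) y < a"
      if "k \<le> Suc n" "u < y" "y < v" for k y
    proof (intro allI impI)
      fix i assume "1 \<le> i" "i < k"
      then show "(T ^^ i) y < a"
        by (intro lt less_le_trans[OF _ that(1)] less_imp_le[OF that(2)] that(3))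
    qed
    have step: "(T ^^ Suc n) x = (T ^^ Suc n) u + (x - u)" if x: "u \<le> x" "x < v" for x
    proof -
      have "z \<notin> D" if z: "(T ^^ n) u < z" "z \<le> (T ^^ n) x" for z
      proof -
        \<comment> \<open>The point of the block whose \<open>n\<close>-th iterate is the supposed
          break \<open>z\<close>.\<close>
        define y where "y = u + (z - (T ^^ n) u)"
        have y: "u < y" "y < v" using z tr[OF x] x by (auto simp: y_def)
        have "(T ^^ n) y = z" using tr[OF less_imp_le[OF y(1)] y(2)] by (simp add: y_def)
        moreover have "(T ^^ n) y \<notin> insert a D" using good y away[of n y] le_SucI by blast
        ultimately show ?thesis by simp
      qed
      then have "{(T ^^ n) u<..(T ^^ n) x} \<inter> D = {}" by auto
      then have "T ((T ^^ n) x) - (T ^^ n) x = T ((T ^^ n) u) - (T ^^ n) u"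
        using in01[of u n] in01[OF x, of n] uv tr[OF x] x
        by (intro piecewise_translationD[OF pt]) auto
      then show ?thesis using tr[OF x] by simp
    qed
    then have trans: "trans (Suc n)" using Suc.IH unfolding trans_def le_Suc_eq by blast
    have "(T ^^ Suc n) u < a"
    proof (rule ccontr)
      assume "\<not> (T ^^ Suc n) u < a"
      then have ge: "a \<le> (T ^^ Suc n) x" if "u \<le> x" "x < v" for x
        using step[OF that] that by simp
      have "?R (Suc n)"
      proof (intro conjI allI impI)
        show "(T ^^ i) x = (T ^^ i) u + (x - u)" if "i \<le> Suc n" "u \<le> x" "x < v" for i x
          using trans that unfolding trans_def by blast
      qed (fact lt ge)+
      moreover have "Suc n \<ge> 1" by simp
      ultimately show False using neg by blast
    qed
    moreover have "(T ^^ Suc n) x < a" if x: "u \<le> x" "x < v" "(T ^^ Suc n) u < a" for x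
    proof (rule ccontr)
      assume c: "\<not> (T ^^ Suc n) x < a"
      \<comment> \<open>If the left end is below \<open>a\<close> but some point is not, this
        interior point lands on \<open>a\<close> exactly.\<close>
      define y where "y = u + (a - (T ^^ Suc n) u)"
      have y: "u < y" "y < v" using c x step[OF x(1,2)] by (auto simp: y_def)
      have "(T ^^ Suc n) y = a" using step[OF less_imp_le[OF y(1)] y(2)] by (simp add: y_def)
      moreover have "(T ^^ Suc n) y \<notin> insert a D" using good y away[of "Suc n" y] by blast
      ultimately show False by simp
    qed
    ultimately have "away (Suc n)" using lt by (auto simp: away_def le_Suc_eq less_Suc_eq_le simp del: funpow.simps)
    then show ?case using trans by simp
  qed
  then have tr: "(T ^^ i) x = (T ^^ i) u + (x - u)" and lt: "1 \<le> i \<Longrightarrow> (T ^^ i) x < a"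
    if "u \<le> x" "x < v" for i x
    using that unfolding trans_def away_def by blast+
  \<comment> \<open>An interval that never returns has infinitely many disjoint translates inside \<open>[0,1)\<close>.\<close>
  have disj: False if "i < j" "u \<le> x" "x < v" "u \<le> y" "y < v" "(T ^^ j) y = (T ^^ i) x" for i j x y
  proof -
    have S: "x \<in> {0..<1}" using that(2,3) uv by auto
    have "(T ^^ i) ((T ^^ (j - i)) y) = (T ^^ i) x" using that(1,6) by (simp add: funpow_add_apply)
    then have "(T ^^ (j - i)) y = x"
      using funpow_cancel[OF bij in01[OF that(4,5)] S] by blast
    moreover have "1 \<le> j - i" using that(1) by simp
    ultimately show False using lt[OF that(4,5)] that(2) uv(2) by fastforce
  qed
  have sep: "v - u \<le> \<bar>(T ^^ i) u - (T ^^ j) u\<bar>" if "i < j" for i j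
  proof (rule ccontr)
    assume c: "\<not> ?thesis"
    show False
    proof (cases "(T ^^ i) u \<le> (T ^^ j) u")
      case True
      let ?x = "u + ((T ^^ j) u - (T ^^ i) u)"
      have "u \<le> ?x" "?x < v" using True c by auto
      then show False using disj[OF that, of ?x u] tr[of ?x i] uv by simp
    next
      case False
      let ?x = "u + ((T ^^ i) u - (T ^^ j) u)"
      have "u \<le> ?x" "?x < v" using False c by auto
      then show False using disj[OF that, of u ?x] tr[of ?x j] uv by simp
    qed
  qed
  \<comment> \<open>Pigeonhole: the left ends of the translates are at least \<open>v - u\<close>
    apart, so they occupy different cells of length \<open>v - u\<close>, of which
    \<open>[0,1)\<close> meets only finitely many.\<close>
  define q where "q i = nat \<lfloor>(T ^^ i) u / (v - u)\<rfloor>" for i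
  have q0: "0 \<le> (T ^^ i) u / (v - u)" "(T ^^ i) u / (v - u) \<le> 1 / (v - u)" for i
    using in01[of u i] uv by (auto intro: divide_right_mono)
  have "inj q"
  proof (rule injI)
    have "q i \<noteq> q j" if "i < j" for i j
    proof
      assume "q i = q j"
      then have "\<lfloor>(T ^^ i) u / (v - u)\<rfloor> = \<lfloor>(T ^^ j) u / (v - u)\<rfloor>"
        using q0(1)[of i] q0(1)[of j] by (simp add: q_def eq_nat_nat_iff)
      then have "\<bar>(T ^^ i) u / (v - u) - (T ^^ j) u / (v - u)\<bar> < 1" by linarith
      moreover have "(T ^^ i) u / (v - u) - (T ^^ j) u / (v - u) = ((T ^^ i) u - (T ^^ j) u) / (v - u)"
        by (simp add: diff_divide_distrib)
      ultimately have "\<bar>(T ^^ i) u - (T ^^ j) u\<bar> < v - u"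
        using uv by (simp add: abs_divide pos_divide_less_eq)
      then show False using sep[OF that] by simp
    qed
    then show "q i = q j \<Longrightarrow> i = j" for i j by (metis linorder_neqE_nat)
  qed
  moreover have "range q \<subseteq> {..nat \<lfloor>1 / (v - u)\<rfloor>}"
    using q0(2) by (auto simp: q_def intro!: nat_mono floor_mono)
  ultimately show False by (meson finite_atMost finite_subset range_inj_infinite)
qed

lemma finite_subset_of_orbit:
  assumes T: "T \<in> IETs" and x: "x \<in> {0..<1}" and "finite D" "D \<subseteq> iet_orbit T x"
  obtains M y where "y \<in> {0..<1}" "\<And>d. d \<in> D \<Longrightarrow> \<exists>k\<le>M. (T ^^ k) d = y"
proof -
  have bij: "bij_betw T {0..<1} {0..<1}" using T IETs_iff by blast
  have "\<forall>d\<in>D. \<exists>n. d = (T ^^ n) x \<or> x = (T ^^ n) d"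
    using assms(4) iet_orbit_iff[OF T x] by blast
  then obtain k where k: "\<And>d. d \<in> D \<Longrightarrow> d = (T ^^ k d) x \<or> x = (T ^^ k d) d" by metis
  \<comment> \<open>Any common bound of the \<open>k d\<close> would do. From \<open>d\<close> to
    \<open>(T ^^ N) x\<close> it takes \<open>N - k d\<close> steps if \<open>d\<close> lies ahead
    of \<open>x\<close> and \<open>N + k d\<close> if it lies behind, hence the bound
    \<open>2 * N\<close>.\<close>
  define N where "N = sum k D"
  have N: "k d \<le> N" if "d \<in> D" for d
    unfolding N_def by (rule member_le_sum) (use assms(3) that in auto)
  show ?thesis
  proof (rule that[of "(T ^^ N) x" "2 * N"])
    show "(T ^^ N) x \<in> {0..<1}" by (rule funpow_in_unit[OF bij x])
    fix d assume d: "d \<in> D"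
    show "\<exists>i\<le>2 * N. (T ^^ i) d = (T ^^ N) x"
    proof (cases "d = (T ^^ k d) x")
      case True
      have "(T ^^ (N - k d)) ((T ^^ k d) x) = (T ^^ N) x"
        using N[OF d] by (simp add: funpow_add_apply)
      then show ?thesis using True N[OF d] by (intro exI[of _ "N - k d"]) auto
    next
      case False
      then have "x = (T ^^ k d) d" using k[OF d] by simp
      then have "(T ^^ N) x = (T ^^ (N + k d)) d" by (simp add: funpow_add_apply[symmetric])
      then show ?thesis using N[OF d] by (intro exI[of _ "N + k d"]) auto
    qed
  qed
qed

text \<open>The first return map to \<open>[a,1)\<close> sends \<open>[a,c)\<close> to the right end
  and \<open>[c,1)\<close> to the left end of the base; \<open>n 1\<close> and \<open>n 2\<close>
  are the return times. The locale separates finding such a base from building the tower over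
  it.\<close>

locale rotation_base =
  fixes T :: "real \<Rightarrow> real" and a c :: real and n :: "nat \<Rightarrow> nat"
  assumes minimal: "minimal_iet T"
    and ac: "0 \<le> a" "a < c" "c < 1"
    and n1: "n 1 \<ge> 1" and n2: "n 2 \<ge> 1"
    and trans1: "\<And>i x. i \<le> n 1 \<Longrightarrow> a \<le> x \<Longrightarrow> x < c \<Longrightarrow> (T ^^ i) x = (T ^^ i) a + (x - a)"
    and trans2: "\<And>i x. i \<le> n 2 \<Longrightarrow> c \<le> x \<Longrightarrow> x < 1 \<Longrightarrow> (T ^^ i) x = (T ^^ i) c + (x - c)"
    and away1: "\<And>i x. 1 \<le> i \<Longrightarrow> i < n 1 \<Longrightarrow> a \<le> x \<Longrightarrow> x < c \<Longrightarrow> (T ^^ i) x < a"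
    and away2: "\<And>i x. 1 \<le> i \<Longrightarrow> i < n 2 \<Longrightarrow> c \<le> x \<Longrightarrow> x < 1 \<Longrightarrow> (T ^^ i) x < a"
    and return1: "(T ^^ n 1) a = a + (1 - c)"
    and return2: "(T ^^ n 2) c = a"

text \<open>Otherwise the point \<open>1 - w + u\<close> of the block would be moved to 1.\<close>

lemma translate_le_one:
  fixes w :: real
  assumes "u < v" "w < 1" "\<And>x. u \<le> x \<Longrightarrow> x < v \<Longrightarrow> w + (x - u) < 1"
  shows "w + (v - u) \<le> 1"
  using assms(3)[of "1 - w + u"] assms(1,2) by fastforce

lemma rotation_base_exists:
  assumes T: "T \<in> IETs" and min: "minimal_iet T"
    and x: "x \<in> {0..<1}" and disc: "discontinuities T \<subseteq> iet_orbit T x"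
  shows "\<exists>a c n. rotation_base T a c n"
proof -
  let ?S = "{0..<1::real}"
  have bij: "bij_betw T ?S ?S" using T IETs_iff by blast
  obtain F where F: "piecewise_translation F T" using T IETs_iff by blast
  define D where "D = F \<inter> discontinuities T"
  have D: "piecewise_translation D T"
    unfolding D_def by (rule piecewise_translation_discontinuities[OF F])
  have "finite D" "D \<subseteq> iet_orbit T x" "D \<subseteq> ?S"
    using D disc by (auto simp: piecewise_translation_def D_def discontinuities_def)
  then obtain M y0 where y0: "y0 \<in> ?S" and M: "\<And>d. d \<in> D \<Longrightarrow> \<exists>k\<le>M. (T ^^ k) d = y0"
    using finite_subset_of_orbit[OF T x] by metis
  define Q where "Q = {z \<in> ?S. \<exists>k\<le>M. (T ^^ k) z = y0}"
  have "Q \<subseteq> (\<lambda>k. inv_into ?S (T ^^ k) y0) ` {..M}"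
  proof
    fix z assume "z \<in> Q"
    then obtain k where "z \<in> ?S" "k \<le> M" "(T ^^ k) z = y0" by (auto simp: Q_def)
    moreover from this have "inv_into ?S (T ^^ k) y0 = z"
      using bij_betw_inv_into_left[OF bij_betw_funpow[OF bij, of k], of z] by simp
    ultimately show "z \<in> (\<lambda>k. inv_into ?S (T ^^ k) y0) ` {..M}" by force
  qed
  then have finQ: "finite Q" by (rule finite_subset) simp
  have "y0 \<in> Q" using y0 by (auto simp: Q_def intro: exI[of _ 0])
  define a where "a = Max Q"
  have aQ: "a \<in> Q" unfolding a_def by (rule Max_in[OF finQ]) (use \<open>y0 \<in> Q\<close> in blast)
  have Qa: "z \<le> a" if "z \<in> Q" for z unfolding a_def by (rule Max_ge[OF finQ that])
  have DQ: "insert a D \<subseteq> Q" using aQ M \<open>D \<subseteq> ?S\<close> by (auto simp: Q_def)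
  have a: "0 \<le> a" "a < 1" using aQ by (auto simp: Q_def)
  \<comment> \<open>\<open>n\<close> may equal the first return time: an orbit that returns exactly
    to \<open>a\<close> counts, since a block around such a point would come to straddle
    \<open>a\<close>.\<close>
  define bad where "bad y \<longleftrightarrow> a < y \<and> y < 1 \<and>
    (\<exists>n. (\<forall>i. 1 \<le> i \<longrightarrow> i < n \<longrightarrow> (T ^^ i) y < a) \<and> (T ^^ n) y \<in> insert a D)" for y
  have bad_unique: "y = y'" if "bad y" "bad y'" for y y'
  proof -
    have *: "y = y'" if y: "a < y" "y < 1" "k \<le> M" "(T ^^ (k + n)) y = y0"
      and y': "a < y'" "y' < 1" "(T ^^ (k' + n')) y' = y0" "k' \<le> M"
        "\<forall>i. 1 \<le> i \<longrightarrow> i < n' \<longrightarrow> (T ^^ i) y' < a"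
      and le: "k + n \<le> k' + n'" for y y' k k' n n'
    proof -
      have S: "y \<in> ?S" "y' \<in> ?S" using y y' a by auto
      \<comment> \<open>The excess of the longer way to \<open>y0\<close>; cancelling the common
        steps puts \<open>y\<close> on the forward orbit of \<open>y'\<close>.\<close>
      define d where "d = (k' + n') - (k + n)"
      have "(T ^^ (k + n)) ((T ^^ d) y') = (T ^^ (k + n)) y"
        using y(4) y'(3) le by (simp add: funpow_add_apply d_def)
      then have d: "(T ^^ d) y' = y"
        using funpow_cancel[OF bij funpow_in_unit[OF bij S(2)] S(1)] by blast
      show ?thesis
      proof (cases "d = 0")
        case False
        \<comment> \<open>A value \<open>0 < d < n'\<close> would place \<open>y\<close> below
          \<open>a\<close>. Hence \<open>d \<ge> n'\<close>, which leaves at most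
          \<open>k' \<le> M\<close> steps from \<open>y\<close> to \<open>y0\<close> and puts
          \<open>y\<close> in \<open>Q\<close>, against \<open>a < y\<close>.\<close>
        have "\<not> d < n'" using y'(5) d y False by (metis One_nat_def Suc_leI less_asym neq0_conv)
        then have "k + n \<le> M" using y' le by (simp add: d_def)
        then have "y \<in> Q" using y a by (auto simp: Q_def)
        then show ?thesis using Qa y by force
      qed (use d in simp)
    qed
    obtain n where n: "\<forall>i. 1 \<le> i \<longrightarrow> i < n \<longrightarrow> (T ^^ i) y < a" "(T ^^ n) y \<in> insert a D"
      using \<open>bad y\<close> unfolding bad_def by blast
    obtain n' where n': "\<forall>i. 1 \<le> i \<longrightarrow> i < n' \<longrightarrow> (T ^^ i) y' < a" "(T ^^ n') y' \<in> insert a D"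
      using \<open>bad y'\<close> unfolding bad_def by blast
    obtain k where k: "k \<le> M" "(T ^^ (k + n)) y = y0"
      using n(2) DQ by (auto simp: Q_def funpow_add_apply)
    obtain k' where k': "k' \<le> M" "(T ^^ (k' + n')) y' = y0"
      using n'(2) DQ by (auto simp: Q_def funpow_add_apply)
    have "a < y" "y < 1" "a < y'" "y' < 1" using that by (auto simp: bad_def)
    then show ?thesis
      using *[of y k n y' k' n'] *[of y' k' n' y k n] k k' n(1) n'(1)
      by (metis nat_le_linear)
  qed
  have in01: "(T ^^ i) y \<in> ?S" if "a \<le> y" "y < 1" for i y
    using that a by (intro funpow_in_unit[OF bij]) auto
  have noper: "(T ^^ i) y \<noteq> y" if "1 \<le> i" "a \<le> y" "y < 1" for i y
    using that a by (intro minimal_not_periodic[OF min]) auto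
  have "\<exists>c. bad c"
  proof (rule ccontr)
    assume "\<nexists>c. bad c"
    then have good: "\<forall>y n. a < y \<longrightarrow> y < 1 \<longrightarrow> (\<forall>i. 1 \<le> i \<longrightarrow> i < n \<longrightarrow> (T ^^ i) y < a) \<longrightarrow>
        (T ^^ n) y \<notin> insert a D"
      unfolding bad_def by blast
    obtain n where n: "n \<ge> 1"
      and tr: "\<And>i x. i \<le> n \<Longrightarrow> a \<le> x \<Longrightarrow> x < 1 \<Longrightarrow> (T ^^ i) x = (T ^^ i) a + (x - a)"
      and ret: "\<And>x. a \<le> x \<Longrightarrow> x < 1 \<Longrightarrow> a \<le> (T ^^ n) x"
      using first_return[OF bij D a(1) order_refl a(2) order_refl good] by blast
    \<comment> \<open>With no bad point the whole base returns as one block. It fits into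
      \<open>[a,1)\<close> only by returning to its own place, and then \<open>a\<close> is
      periodic.\<close>
    have "(T ^^ n) a + (1 - a) \<le> 1"
    proof (rule translate_le_one[OF a(2)])
      show "(T ^^ n) a < 1" using in01[of a n] a by simp
      show "(T ^^ n) a + (x - a) < 1" if "a \<le> x" "x < 1" for x
        using tr[OF order_refl that] in01[OF that, of n] by simp
    qed
    then have "(T ^^ n) a = a" using ret[of a] a by simp
    then show False using noper[OF n, of a] a by simp
  qed
  then obtain c where c: "bad c" by blast
  then have ac: "a < c" "c < 1" by (auto simp: bad_def)
  have good: "(T ^^ n) y \<notin> insert a D"
    if "a < y" "y < 1" "y \<noteq> c" "\<forall>i. 1 \<le> i \<longrightarrow> i < n \<longrightarrow> (T ^^ i) y < a" for y n
  proof
    assume "(T ^^ n) y \<in> insert a D"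
    then have "bad y" using that unfolding bad_def by blast
    then show False using bad_unique[OF c, of y] that by simp
  qed
  have good1: "\<forall>y n. a < y \<longrightarrow> y < c \<longrightarrow> (\<forall>i. 1 \<le> i \<longrightarrow> i < n \<longrightarrow> (T ^^ i) y < a) \<longrightarrow>
      (T ^^ n) y \<notin> insert a D"
  proof (intro allI impI)
    fix y n
    assume y: "a < y" "y < c" and away: "\<forall>i. 1 \<le> i \<longrightarrow> i < n \<longrightarrow> (T ^^ i) y < a"
    have "a < y" "y < 1" "y \<noteq> c" using y ac by auto
    then show "(T ^^ n) y \<notin> insert a D" using good away by blast
  qed
  have good2: "\<forall>y n. c < y \<longrightarrow> y < 1 \<longrightarrow> (\<forall>i. 1 \<le> i \<longrightarrow> i < n \<longrightarrow> (T ^^ i) y < a) \<longrightarrow>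
      (T ^^ n) y \<notin> insert a D"
  proof (intro allI impI)
    fix y n
    assume y: "c < y" "y < 1" and away: "\<forall>i. 1 \<le> i \<longrightarrow> i < n \<longrightarrow> (T ^^ i) y < a"
    have "a < y" "y < 1" "y \<noteq> c" using y ac by auto
    then show "(T ^^ n) y \<notin> insert a D" using good away by blast
  qed
  obtain n1 where n1: "n1 \<ge> 1"
    and tr1: "\<And>i x. i \<le> n1 \<Longrightarrow> a \<le> x \<Longrightarrow> x < c \<Longrightarrow> (T ^^ i) x = (T ^^ i) a + (x - a)"
    and aw1: "\<And>i x. 1 \<le> i \<Longrightarrow> i < n1 \<Longrightarrow> a \<le> x \<Longrightarrow> x < c \<Longrightarrow> (T ^^ i) x < a"
    and ret1: "\<And>x. a \<le> x \<Longrightarrow> x < c \<Longrightarrow> a \<le> (T ^^ n1) x"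
    using first_return[OF bij D a(1) order_refl ac(1) less_imp_le[OF ac(2)] good1] by blast
  obtain n2 where n2: "n2 \<ge> 1"
    and tr2: "\<And>i x. i \<le> n2 \<Longrightarrow> c \<le> x \<Longrightarrow> x < 1 \<Longrightarrow> (T ^^ i) x = (T ^^ i) c + (x - c)"
    and aw2: "\<And>i x. 1 \<le> i \<Longrightarrow> i < n2 \<Longrightarrow> c \<le> x \<Longrightarrow> x < 1 \<Longrightarrow> (T ^^ i) x < a"
    and ret2: "\<And>x. c \<le> x \<Longrightarrow> x < 1 \<Longrightarrow> a \<le> (T ^^ n2) x"
    using first_return[OF bij D a(1) less_imp_le[OF ac(1)] ac(2) order_refl good2] by blast
  define s where "s = (T ^^ n1) a"
  define s' where "s' = (T ^^ n2) c"
  have s: "a \<le> s" "s < 1" using ret1[of a] in01[of a n1] ac by (auto simp: s_def)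
  have s': "a \<le> s'" "s' < 1" using ret2[of c] in01[of c n2] ac by (auto simp: s'_def)
  have end1: "s + (c - a) \<le> 1"
  proof (rule translate_le_one[OF ac(1) s(2)])
    show "s + (x - a) < 1" if "a \<le> x" "x < c" for x
      using tr1[OF order_refl that] in01[of x n1] that ac by (simp add: s_def)
  qed
  have end2: "s' + (1 - c) \<le> 1"
  proof (rule translate_le_one[OF ac(2) s'(2)])
    show "s' + (x - c) < 1" if "c \<le> x" "x < 1" for x
      using tr2[OF order_refl that] in01[of x n2] that ac by (simp add: s'_def)
  qed
  \<comment> \<open>The two returning blocks do not overlap: cancelling the smaller number of
    iterates at a common point would show one base point as a premature return of the other.\<close>
  have disj: False if xz: "a \<le> x" "x < c" "c \<le> z" "z < 1" "(T ^^ n1) x = (T ^^ n2) z" for x z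
  proof -
    have S: "x \<in> ?S" "z \<in> ?S" using xz a ac by auto
    consider "n1 = n2" | "n1 < n2" | "n2 < n1" by linarith
    then show False
    proof cases
      case 1
      then have "x = z" using funpow_cancel[OF bij S] xz by simp
      then show False using xz by simp
    next
      case 2
      then have "(T ^^ n1) ((T ^^ (n2 - n1)) z) = (T ^^ n1) x" using xz by (simp add: funpow_add_apply)
      then have "(T ^^ (n2 - n1)) z = x"
        using funpow_cancel[OF bij funpow_in_unit[OF bij S(2)] S(1)] by blast
      moreover have "1 \<le> n2 - n1" "n2 - n1 < n2" using 2 n1 by auto
      ultimately show False using aw2[of "n2 - n1" z] xz by simp
    next
      case 3
      then have "(T ^^ n2) ((T ^^ (n1 - n2)) x) = (T ^^ n2) z" using xz by (simp add: funpow_add_apply)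
      then have "(T ^^ (n1 - n2)) x = z"
        using funpow_cancel[OF bij funpow_in_unit[OF bij S(1)] S(2)] by blast
      moreover have "1 \<le> n1 - n2" "n1 - n2 < n1" using 3 n2 by auto
      ultimately show False using aw1[of "n1 - n2" x] xz ac by simp
    qed
  qed
  have "s + (c - a) \<le> s' \<or> s' + (1 - c) \<le> s"
  proof (rule ccontr)
    assume neg: "\<not> ?thesis"
    \<comment> \<open>The larger of the two left ends lies in both blocks whenever they
      overlap.\<close>
    let ?z = "max s s'"
    have x: "a \<le> a + (?z - s)" "a + (?z - s) < c" "c \<le> c + (?z - s')" "c + (?z - s') < 1"
      using neg ac by auto
    have "(T ^^ n1) (a + (?z - s)) = (T ^^ n2) (c + (?z - s'))"
      using tr1[OF order_refl x(1,2)] tr2[OF order_refl x(3,4)] by (simp add: s_def s'_def)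
    then show False using disj x by blast
  qed
  \<comment> \<open>Two disjoint blocks that together have the length of the base can be placed in
    two ways; the one that keeps their order fixes \<open>a\<close>.\<close>
  moreover have "s \<noteq> a" using noper[OF n1, of a] a by (simp add: s_def)
  ultimately have "s = a + (1 - c)" "s' = a" using s s' end1 end2 by auto
  then have ret: "(T ^^ n1) a = a + (1 - c)" "(T ^^ n2) c = a" by (simp_all add: s_def s'_def)
  define n where "n j = (if j = 1 then n1 else n2)" for j :: nat
  have n: "n 1 = n1" "n 2 = n2" by (simp_all add: n_def)
  have "rotation_base T a c n"
    by (unfold_locales; (unfold n)?)
      (fact min a ac n1 n2 tr1 tr2 aw1 aw2 ret)+
  then show ?thesis by blast
qed

section \<open>Towers and conjugacy\<close>

lemma lex_key_less_iff:
  fixes j j' k k' m :: nat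
  assumes "j \<le> m" "j' \<le> m"
  shows "Suc m * k + j < Suc m * k' + j' \<longleftrightarrow> k < k' \<or> k = k' \<and> j < j'"
proof -
  have less: "Suc m * k + j < Suc m * k' + j'" if "k < k'" "j \<le> m" for k k' j j'
  proof -
    have "Suc m * k + j < Suc m * Suc k" using that by simp
    also have "\<dots> \<le> Suc m * k'" using that by (intro mult_le_mono2) simp
    finally show ?thesis by simp
  qed
  consider "k < k'" | "k = k'" | "k' < k" by linarith
  then show ?thesis
  proof cases
    case 3
    then show ?thesis using less[of k' k j' j] assms by auto
  qed (use less[of k k' j j'] assms in auto)
qed

definition tower_blocks :: "nat \<Rightarrow> (nat \<Rightarrow> nat) \<Rightarrow> (nat \<times> nat) set" where
  "tower_blocks m n = {(k, j). j \<in> {1..m} \<and> 1 \<le> k \<and> k \<le> n j}"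

text \<open>Lexicographic order, level before interval, coded as one number because the keys of
  \<open>block_start\<close> are natural numbers; the code is faithful as
  \<open>j \<le> m\<close>.\<close>

abbreviation tower_key :: "nat \<Rightarrow> nat \<times> nat \<Rightarrow> nat" where
  "tower_key m \<equiv> (\<lambda>(k, j). Suc m * k + j)"

lemma tower_blocks_eq: "tower_blocks m n = prod.swap ` (SIGMA j:{1..m}. {1..n j})"
  by (auto simp: tower_blocks_def image_iff)

lemma finite_tower_blocks: "finite (tower_blocks m n)"
  unfolding tower_blocks_eq by (intro finite_imageI finite_SigmaI) auto

lemma sum_tower_blocks: "(\<Sum>b\<in>tower_blocks m n. l (snd b)) = (\<Sum>j\<in>{1..m}. real (n j) * l j)"
proof -
  have "(\<Sum>b\<in>tower_blocks m n. l (snd b)) = (\<Sum>b\<in>(SIGMA j:{1..m}. {1..n j}). l (fst b))"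
    unfolding tower_blocks_eq by (subst sum.reindex) auto
  also have "\<dots> = (\<Sum>j\<in>{1..m}. \<Sum>k\<in>{1..n j}. l j)"
    by (subst sum.Sigma) (auto simp: case_prod_beta)
  finally show ?thesis by simp
qed

lemma inj_on_tower_key: "inj_on (tower_key m) (tower_blocks m n)"
proof (rule inj_onI, clarify)
  fix k j k' j'
  assume "(k, j) \<in> tower_blocks m n" "(k', j') \<in> tower_blocks m n"
    and eq: "Suc m * k + j = Suc m * k' + j'"
  then have "j \<le> m" "j' \<le> m" by (auto simp: tower_blocks_def)
  then show "k = k' \<and> j = j'"
    using lex_key_less_iff[of j m j' k k'] lex_key_less_iff[of j' m j k' k] eq by auto
qed

text \<open>Identifies the two sums in \<open>tower_pos\<close>, full lower levels and earlier
  pieces of the same level, as one block start, so that the facts on blocks apply to towers.\<close>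

lemma block_start_tower:
  assumes "(i, j) \<in> tower_blocks m n"
  shows "block_start (tower_key m) (tower_blocks m n) (\<lambda>b. l (snd b)) (i, j) =
    (\<Sum>k\<in>{1..<i}. \<Sum>j' | j' \<in> {1..m} \<and> k \<le> n j'. l j')
      + (\<Sum>j' | j' \<in> {1..m} \<and> j' < j \<and> i \<le> n j'. l j')"
proof -
  let ?P = "SIGMA k:{1..<i}. {j' \<in> {1..m}. k \<le> n j'}"
  let ?Q = "{i} \<times> {j'. j' \<in> {1..m} \<and> j' < j \<and> i \<le> n j'}"
  have i: "1 \<le> i" "j \<le> m" using assms by (auto simp: tower_blocks_def)
  have "b \<in> tower_blocks m n \<and> tower_key m b < tower_key m (i, j) \<longleftrightarrow> b \<in> ?P \<union> ?Q" for b
  proof (cases b)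
    case (Pair k j')
    show ?thesis
    proof (cases "j' \<le> m")
      case True
      then show ?thesis
        using lex_key_less_iff[OF True i(2), of k i] i(1) unfolding Pair tower_blocks_def
        by (auto simp del: mult_Suc)
    qed (auto simp: Pair tower_blocks_def)
  qed
  then have "{b \<in> tower_blocks m n. tower_key m b < tower_key m (i, j)} = ?P \<union> ?Q" by blast
  moreover have "(\<Sum>b\<in>?P \<union> ?Q. l (snd b)) = (\<Sum>b\<in>?P. l (snd b)) + (\<Sum>b\<in>?Q. l (snd b))"
    by (intro sum.union_disjoint) auto
  moreover have "(\<Sum>b\<in>?P. l (snd b)) = (\<Sum>k\<in>{1..<i}. \<Sum>j' | j' \<in> {1..m} \<and> k \<le> n j'. l j')"
    by (subst sum.Sigma) (auto simp: case_prod_beta)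
  moreover have "(\<Sum>b\<in>?Q. l (snd b)) = (\<Sum>j' | j' \<in> {1..m} \<and> j' < j \<and> i \<le> n j'. l j')"
    by (subst sum.cartesian_product') simp
  ultimately show ?thesis by (simp only: block_start_def)
qed

lemma tower_pos_eq:
  assumes "iet_index m l x = j" "(i, j) \<in> tower_blocks m n"
  shows "tower_pos m l n (x, i) =
    (block_start (tower_key m) (tower_blocks m n) (\<lambda>b. l (snd b)) (i, j) + (x - break_pt l (j - 1)))
      / (\<Sum>b\<in>tower_blocks m n. l (snd b))"
  using assms unfolding tower_pos_def sum_tower_blocks block_start_tower[OF assms(2)]
  by (simp add: Let_def)

text \<open>Multiplication by the total length \<open>t\<close> undoes the rescaling. The piece of
  level \<open>i\<close> over interval \<open>j\<close> then fills the block \<open>(i, j)\<close>,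
  and bijectivity amounts to existence and uniqueness of the block around a point.\<close>

lemma tower_pos_bij_betw:
  assumes d: "iet_data m p l" and n: "\<And>j. j \<in> {1..m} \<Longrightarrow> n j \<ge> 1"
  shows "bij_betw (tower_pos m l n) (tower_dom m l n) {0..<1}"
proof -
  let ?A = "tower_blocks m n" and ?w = "\<lambda>b :: nat \<times> nat. l (snd b)"
  let ?b = "block_start (tower_key m) ?A ?w"
  define t where "t = sum ?w ?A"
  have pos: "?w b > 0" if "b \<in> ?A" for b
    using iet_dataD(1)[OF d, of "snd b"] that by (auto simp: tower_blocks_def)
  have "m \<ge> 1" using d by (simp add: iet_data_def)
  then have "(1, 1) \<in> ?A" using n[of 1] by (simp add: tower_blocks_def)
  then have t: "t > 0"
    unfolding t_def using pos by (intro sum_pos finite_tower_blocks) auto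
  have dom: "(x, i) \<in> tower_dom m l n \<longleftrightarrow> x \<in> {0..<1} \<and> (i, iet_index m l x) \<in> ?A" for x i
    using iet_index_correct(1)[OF d, of x] by (auto simp: tower_dom_def tower_blocks_def)
  have pos_eq: "tower_pos m l n (x, i) * t = ?b (i, iet_index m l x) + (x - break_pt l (iet_index m l x - 1))"
    if "(x, i) \<in> tower_dom m l n" for x i
    using tower_pos_eq[OF refl, of i m l x n] that t by (simp add: dom t_def)
  have in_block: "?b (i, iet_index m l x) \<le> tower_pos m l n (x, i) * t"
      "tower_pos m l n (x, i) * t < ?b (i, iet_index m l x) + ?w (i, iet_index m l x)"
    if "(x, i) \<in> tower_dom m l n" for x i
  proof -
    have x: "x \<in> {0..<1}" using that by (simp add: dom)
    note j = iet_index_correct[OF d x]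
    show "?b (i, iet_index m l x) \<le> tower_pos m l n (x, i) * t"
      "tower_pos m l n (x, i) * t < ?b (i, iet_index m l x) + ?w (i, iet_index m l x)"
      using j(2) unfolding pos_eq[OF that]
      by (simp_all add: iet_interval_def break_pt_eq_block_start[OF j(1)] del: One_nat_def)
  qed
  show ?thesis
  proof (rule bij_betwI')
    fix z z' assume z: "z \<in> tower_dom m l n" "z' \<in> tower_dom m l n"
    obtain x i x' i' where zz: "z = (x, i)" "z' = (x', i')" by (cases z, cases z') auto
    show "(tower_pos m l n z = tower_pos m l n z') = (z = z')"
    proof
      assume eq: "tower_pos m l n z = tower_pos m l n z'"
      have zd: "(x, i) \<in> tower_dom m l n" "(x', i') \<in> tower_dom m l n" using z zz by auto
      then have mem: "(i, iet_index m l x) \<in> ?A" "(i', iet_index m l x') \<in> ?A"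
        by (simp_all add: dom)
      have eq': "tower_pos m l n (x', i') = tower_pos m l n (x, i)" using eq zz by simp
      have *: "(i, iet_index m l x) = (i', iet_index m l x')"
        by (rule block_unique[of ?A "tower_key m" ?w _ _ "tower_pos m l n (x, i) * t"])
          (fact finite_tower_blocks inj_on_tower_key pos mem in_block[OF zd(1)]
            in_block[OF zd(2), unfolded eq'])+
      then have idx: "i = i'" "iet_index m l x = iet_index m l x'" by blast+
      have "x = x'"
        using pos_eq[OF zd(1)] pos_eq[OF zd(2), unfolded eq'] unfolding idx by linarith
      then show "z = z'" using idx(1) zz by blast
    qed simp
  next
    fix z assume z: "z \<in> tower_dom m l n"
    obtain x i where zz: "z = (x, i)" by (cases z) auto
    have a: "(i, iet_index m l x) \<in> ?A" using z zz dom by simp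
    have "0 \<le> ?b (i, iet_index m l x)"
      by (rule block_bounds(1)) (fact finite_tower_blocks pos a)+
    moreover have "?b (i, iet_index m l x) + ?w (i, iet_index m l x) \<le> t"
      unfolding t_def by (rule block_bounds(2)) (fact finite_tower_blocks pos a)+
    moreover have "(x, i) \<in> tower_dom m l n" using z zz by simp
    note in_block[OF this]
    ultimately have "0 \<le> tower_pos m l n z * t \<and> tower_pos m l n z * t < t"
      unfolding zz by linarith
    then show "tower_pos m l n z \<in> {0..<1}"
      using t by (simp add: zero_le_mult_iff)
  next
    fix y :: real assume y: "y \<in> {0..<1}"
    have "0 \<le> y * t" "y * t < sum ?w ?A" using y t by (auto simp: t_def[symmetric])
    then obtain b where b: "b \<in> ?A" "?b b \<le> y * t" "y * t < ?b b + ?w b"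
      using block_exists[of ?A "tower_key m" ?w "y * t"] finite_tower_blocks inj_on_tower_key pos
      by metis
    obtain i j where ij: "b = (i, j)" by (cases b)
    have j: "j \<in> {1..m}" using b ij by (auto simp: tower_blocks_def)
    define x where "x = break_pt l (j - 1) + (y * t - ?b b)"
    have xj: "x \<in> iet_interval l j"
      using b j by (simp add: x_def iet_interval_def break_pt_eq_block_start[OF j] ij del: One_nat_def)
    have ix: "iet_index m l x = j" by (rule iet_index_eqI[OF d j xj])
    have xd: "(x, i) \<in> tower_dom m l n"
      using iet_interval_subset[OF d j] xj b(1) unfolding dom ix ij by blast
    have "tower_pos m l n (x, i) * t = y * t"
      unfolding pos_eq[OF xd] ix by (simp add: x_def ij)
    then have "y = tower_pos m l n (x, i)" using t by simp
    then show "\<exists>z\<in>tower_dom m l n. y = tower_pos m l n z" using xd by blast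
  qed
qed

lemma tower_step_in_dom:
  assumes d: "iet_data m p l" and n: "\<And>j. j \<in> {1..m} \<Longrightarrow> n j \<ge> 1" and z: "z \<in> tower_dom m l n"
  shows "tower_step m p l n z \<in> tower_dom m l n"
proof -
  obtain x i where zz: "z = (x, i)" by (cases z)
  have x: "x \<in> {0..<1}" using z zz by (simp add: tower_dom_def)
  then have "iet_map m p l x \<in> {0..<1}" using bij_betwE[OF iet_map_bij_betw[OF d]] by blast
  moreover from this have "n (iet_index m l (iet_map m p l x)) \<ge> 1"
    using n iet_index_correct(1)[OF d] by blast
  ultimately show ?thesis using x zz by (auto simp: tower_step_def tower_dom_def)
qed

section \<open>Conjugation in the group of IETs\<close>

text \<open>\<open>m_inv\<close> is a description over the carrier, and \<open>IET_group\<close>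
  only shrinks the carrier of \<open>BijGroup\<close>. The inverse bijection is the one described
  because it is again an IET.\<close>

lemma inv_IET_group:
  assumes "g \<in> IETs"
  shows "inv\<^bsub>IET_group\<^esub> g = restrict (inv_into {0..<1} g) {0..<1}"
proof -
  let ?S = "{0..<1::real}" and ?h = "restrict (inv_into {0..<1} g) {0..<1}"
  have h: "?h \<in> IETs" by (rule iet_inverse[OF assms])
  have sub: "IETs \<subseteq> Bij ?S" using IETs_iff by (auto simp: Bij_def)
  then have B: "g \<in> Bij ?S" "?h \<in> Bij ?S" using assms h by auto
  interpret group "BijGroup ?S" by (rule group_BijGroup)
  have inv: "?h = inv\<^bsub>BijGroup ?S\<^esub> g" using inv_BijGroup[OF B(1)] by simp
  have eqs: "mult IET_group = mult (BijGroup ?S)" "\<one>\<^bsub>IET_group\<^esub> = \<one>\<^bsub>BijGroup ?S\<^esub>"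
    "carrier IET_group = IETs"
    by (simp_all add: IET_group_def)
  show ?thesis
    unfolding m_inv_def eqs
  proof (rule the_equality)
    show "?h \<in> IETs \<and> g \<otimes>\<^bsub>BijGroup ?S\<^esub> ?h = \<one>\<^bsub>BijGroup ?S\<^esub> \<and> ?h \<otimes>\<^bsub>BijGroup ?S\<^esub> g = \<one>\<^bsub>BijGroup ?S\<^esub>"
      unfolding inv using h B(1) r_inv[of g] l_inv[of g] unfolding inv carrier_BijGroup by blast
    fix y
    assume y: "y \<in> IETs \<and> g \<otimes>\<^bsub>BijGroup ?S\<^esub> y = \<one>\<^bsub>BijGroup ?S\<^esub> \<and> y \<otimes>\<^bsub>BijGroup ?S\<^esub> g = \<one>\<^bsub>BijGroup ?S\<^esub>"
    then show "y = ?h"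
      unfolding inv using inv_equality[of y g] B(1) sub unfolding carrier_BijGroup by blast
  qed
qed

text \<open>Agreement with the conjugate of \<open>f\<close> by \<open>g\<close> itself proves that
  \<open>h\<close> is an IET. For towers, only the conjugating map has to be examined for
  breaks.\<close>

lemma conjugate_in_IET_groupI:
  assumes f: "f \<in> IETs" and g: "g \<in> IETs" and h: "h \<in> extensional {0..<1}"
    and eq: "\<And>x. x \<in> {0..<1} \<Longrightarrow> h (g x) = g (f x)"
  shows "conjugate_in IET_group f h"
proof -
  let ?S = "{0..<1::real}" and ?k = "restrict (inv_into {0..<1} g) {0..<1}"
  have k: "?k \<in> IETs" by (rule iet_inverse[OF g])
  have B: "f' \<in> Bij ?S" if "f' \<in> IETs" for f' using that IETs_iff by (auto simp: Bij_def)
  have gb: "bij_betw g ?S ?S" using g IETs_iff by blast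
  have gf: "compose ?S g f \<in> IETs" by (rule iet_compose[OF f g])
  have m: "x \<otimes>\<^bsub>IET_group\<^esub> y = compose ?S x y" if "x \<in> IETs" "y \<in> IETs" for x y
    using mult_BijGroup[OF B B, OF that] by (simp add: IET_group_def)
  have "h = compose ?S (compose ?S g f) ?k"
  proof
    fix y
    show "h y = compose ?S (compose ?S g f) ?k y"
    proof (cases "y \<in> ?S")
      case True
      have i: "inv_into ?S g y \<in> ?S" using bij_betwE[OF bij_betw_inv_into[OF gb]] True by blast
      have "g (inv_into ?S g y) = y" by (rule bij_betw_inv_into_right[OF gb True])
      then have "h y = g (f (inv_into ?S g y))" using eq[OF i] by simp
      then show ?thesis using True i by (simp add: compose_def)
    next
      case False
      then show ?thesis using h by (auto simp: compose_def extensional_def)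
    qed
  qed
  moreover have "compose ?S (compose ?S g f) ?k \<in> IETs" by (rule iet_compose[OF k gf])
  ultimately have "h \<in> IETs" "h = g \<otimes>\<^bsub>IET_group\<^esub> f \<otimes>\<^bsub>IET_group\<^esub> inv\<^bsub>IET_group\<^esub> g"
    using m[OF g f] m[OF gf k] inv_IET_group[OF g] by simp_all
  moreover have "carrier IET_group = IETs" by (simp add: IET_group_def)
  ultimately show ?thesis using f g unfolding conjugate_in_def by blast
qed

section \<open>The tower over the first return map\<close>

context rotation_base
begin

abbreviation width :: real where "width \<equiv> 1 - a"

definition floor_pt :: "real \<Rightarrow> real" where "floor_pt x = (if x < c then a else c)"

definition height :: "real \<Rightarrow> nat" where "height x = (if x < c then n 1 else n 2)"

definition base_perm :: "nat \<Rightarrow> nat" where "base_perm = Transposition.transpose 1 2"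

definition base_len :: "nat \<Rightarrow> real" where
  "base_len j = (if j = 1 then (c - a) / width else (1 - c) / width)"

definition lift :: "real \<Rightarrow> real" where "lift x = a + width * x"

abbreviation rot :: "real \<Rightarrow> real" where "rot \<equiv> iet_map 2 base_perm base_len"

abbreviation levels :: "(real \<times> nat) set" where "levels \<equiv> tower_dom 2 base_len n"

text \<open>Identifies the abstract tower with \<open>[0,1)\<close>. Levels count from 1, so level
  \<open>i\<close> is reached after \<open>i - 1\<close> iterates.\<close>

definition climb :: "real \<times> nat \<Rightarrow> real" where "climb = (\<lambda>(x, i). (T ^^ (i - 1)) (lift x))"

section \<open>The levels over the base fill the unit interval\<close>

lemma T_IETs: "T \<in> IETs"
  using minimal by (simp add: minimal_iet_def)

lemma T_bij: "bij_betw T {0..<1} {0..<1}"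
  using T_IETs IETs_iff by blast

lemma in01: "a \<le> x \<Longrightarrow> x < 1 \<Longrightarrow> (T ^^ i) x \<in> {0..<1}"
  using ac by (intro funpow_in_unit[OF T_bij]) auto

lemma height_pos: "height x \<ge> 1"
  using n1 n2 by (simp add: height_def)

lemma translate:
  "i \<le> height x \<Longrightarrow> a \<le> x \<Longrightarrow> x < 1 \<Longrightarrow> (T ^^ i) x = (T ^^ i) (floor_pt x) + (x - floor_pt x)"
  using trans1[of i x] trans2[of i x] by (cases "x < c") (auto simp: height_def floor_pt_def)

lemma away: "1 \<le> i \<Longrightarrow> i < height x \<Longrightarrow> a \<le> x \<Longrightarrow> x < 1 \<Longrightarrow> (T ^^ i) x < a"
  using away1[of i x] away2[of i x] by (cases "x < c") (auto simp: height_def)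

lemma return_lower: "a \<le> x \<Longrightarrow> x < c \<Longrightarrow> (T ^^ height x) x = x + (1 - c)"
  using trans1[OF order_refl, of x] return1 by (simp add: height_def)

lemma return_upper: "c \<le> x \<Longrightarrow> x < 1 \<Longrightarrow> (T ^^ height x) x = x - (c - a)"
  using trans2[OF order_refl, of x] return2 by (simp add: height_def)

text \<open>With different heights, cancelling the smaller one would exhibit a point of the base as
  an iterate of another base point before its return, hence below \<open>a\<close>.\<close>

lemma climb_unique:
  assumes x: "a \<le> x" "x < 1" "i < height x" and y: "a \<le> y" "y < 1" "j < height y"
    and eq: "(T ^^ i) x = (T ^^ j) y"
  shows "x = y \<and> i = j"
proof -
  have less: False if "a \<le> x" "x < 1" "a \<le> y" "y < 1" "j < height y" "(T ^^ i) x = (T ^^ j) y" "i < j"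
    for x y i j
  proof -
    have "(T ^^ i) ((T ^^ (j - i)) y) = (T ^^ i) x" using that(6,7) by (simp add: funpow_add_apply)
    moreover have "x \<in> {0..<1}" using that ac by auto
    ultimately have "(T ^^ (j - i)) y = x"
      using funpow_cancel[OF T_bij in01[OF that(3,4)]] by blast
    moreover have "1 \<le> j - i" "j - i < height y" using that by auto
    ultimately show False using away[of "j - i" y] that by simp
  qed
  have "i = j" using less[of x y j i] less[of y x i j] assms by (metis linorder_neqE_nat)
  moreover have "x \<in> {0..<1}" "y \<in> {0..<1}" using x y ac by auto
  ultimately show ?thesis using funpow_cancel[OF T_bij] eq by blast
qed

definition climbs :: "real set" where
  "climbs = {z. \<exists>x i. a \<le> x \<and> x < 1 \<and> i < height x \<and> z = (T ^^ i) x}"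

lemma climbsI: "a \<le> x \<Longrightarrow> x < 1 \<Longrightarrow> i < height x \<Longrightarrow> (T ^^ i) x \<in> climbs"
  by (auto simp: climbs_def)

lemma base_in_climbs: "a \<le> x \<Longrightarrow> x < 1 \<Longrightarrow> x \<in> climbs"
  using climbsI[of x 0] height_pos[of x] by simp

lemma climbs_forward:
  assumes "z \<in> climbs"
  shows "T z \<in> climbs"
proof -
  obtain x i where x: "a \<le> x" "x < 1" "i < height x" "z = (T ^^ i) x"
    using assms by (auto simp: climbs_def)
  show ?thesis
  proof (cases "Suc i < height x")
    case True
    then show ?thesis using climbsI[OF x(1,2) True] x(4) by simp
  next
    case False
    then have "T z = (T ^^ height x) x" using x by (metis Suc_lessI comp_apply funpow.simps(2))
    then show ?thesis
      using return_lower[OF x(1)] return_upper[of x] x(1,2) ac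
      by (cases "x < c") (auto intro!: base_in_climbs)
  qed
qed

lemma climbs_backward:
  assumes z: "z \<in> {0..<1}" and "T z \<in> climbs"
  shows "z \<in> climbs"
proof -
  obtain x i where x: "a \<le> x" "x < 1" "i < height x" "T z = (T ^^ i) x"
    using assms(2) by (auto simp: climbs_def)
  have *: "z \<in> climbs" if y: "a \<le> y" "y < 1" "k \<le> height y" "1 \<le> k" "T z = (T ^^ k) y" for y k
  proof -
    have "T z = T ((T ^^ (k - 1)) y)"
      using y(4,5) by (metis Suc_pred' comp_apply funpow.simps(2) less_eq_Suc_le One_nat_def)
    then have "z = (T ^^ (k - 1)) y"
      using bij_betw_imp_inj_on[OF T_bij] z in01[OF y(1,2)] by (meson inj_onD)
    then show ?thesis using climbsI[OF y(1,2), of "k - 1"] y by simp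
  qed
  show ?thesis
  proof (cases "i = 0")
    case False
    then show ?thesis using *[OF x(1,2), of i] x by simp
  next
    case True
    then have Tz: "T z = x" using x by simp
    \<comment> \<open>The preimage of \<open>x\<close> under the return map: the left part of the
      base, of length \<open>1 - c\<close>, comes from \<open>[c,1)\<close>, and the rest from
      \<open>[a,c)\<close>.\<close>
    define y where "y = (if x < a + (1 - c) then x + (c - a) else x - (1 - c))"
    have y: "a \<le> y" "y < 1" using x ac by (auto simp: y_def)
    have "(T ^^ height y) y = x"
    proof (cases "x < a + (1 - c)")
      case True
      then have "y = x + (c - a)" by (simp add: y_def)
      then show ?thesis using return_upper[of y] y x by simp
    next
      case False
      then have "y = x - (1 - c)" by (simp add: y_def)
      then show ?thesis using return_lower[of y] y x by simp
    qed
    then show ?thesis using *[OF y order_refl height_pos] Tz by simp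
  qed
qed

text \<open>The set \<open>climbs\<close> contains the base and is closed under \<open>T\<close> and
  under taking preimages in \<open>[0,1)\<close>; by minimality every orbit meets the base.\<close>

lemma unit_subset_climbs:
  assumes z: "z \<in> {0..<1}"
  shows "z \<in> climbs"
proof -
  obtain y where y: "a < y" "y < 1" "y \<in> iet_orbit T z"
    using minimal_orbit_meets[OF minimal z, of a 1] ac by auto
  have yc: "y \<in> climbs" using y by (intro base_in_climbs) auto
  have fwd: "(T ^^ k) y \<in> climbs" for k
    by (induction k) (use yc climbs_forward in auto)
  have bwd: "w \<in> climbs" if "w \<in> {0..<1}" "(T ^^ k) w \<in> climbs" for k w
    using that
  proof (induction k arbitrary: w)
    case (Suc k)
    have "T w \<in> {0..<1}" using bij_betwE[OF T_bij] Suc.prems(1) by blast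
    moreover have "(T ^^ k) (T w) \<in> climbs" using Suc.prems(2) by (simp add: funpow_swap1)
    ultimately have "T w \<in> climbs" by (rule Suc.IH)
    then show ?case by (rule climbs_backward[OF Suc.prems(1)])
  qed simp
  obtain k where "y = (T ^^ k) z \<or> z = (T ^^ k) y"
    using y(3) iet_orbit_iff[OF T_IETs z] by blast
  then show ?thesis using fwd[of k] bwd[OF z, of k] yc by auto
qed

section \<open>The return map as a minimal rotation\<close>

lemma width_pos: "width > 0"
  using ac by simp

lemma base_len_pos: "base_len j > 0"
  using ac by (simp add: base_len_def)

lemma width_base_len: "width * base_len j = (if j = 1 then c - a else 1 - c)"
  using width_pos by (simp add: base_len_def)

lemma base_len_sum: "base_len 1 + base_len 2 = 1"
  using width_pos by (simp add: base_len_def add_divide_distrib[symmetric])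

lemma base_data: "iet_data 2 base_perm base_len"
proof -
  have "{1..2::nat} = {1, 2}" by auto
  moreover have "base_perm permutes {1..2}"
    unfolding base_perm_def by (intro permutes_swap_id) auto
  ultimately show ?thesis
    using base_len_pos base_len_sum by (auto simp: iet_data_def)
qed

lemma base_rotation: "rotation_data base_perm base_len"
  using base_data by (simp add: rotation_data_def base_perm_def)

lemma lift_less_iff: "lift x < lift y \<longleftrightarrow> x < y"
  using width_pos by (simp add: lift_def)

lemma lift_inject: "lift x = lift y \<longleftrightarrow> x = y"
  using width_pos by (simp add: lift_def)

lemma lift_in: "x \<in> {0..<1} \<Longrightarrow> a \<le> lift x \<and> lift x < 1"
  using lift_less_iff[of x 1] width_pos by (auto simp: lift_def)

lemma lift_onto:
  assumes "a \<le> y" "y < 1"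
  shows "(y - a) / width \<in> {0..<1}" "lift ((y - a) / width) = y"
  using assms width_pos by (auto simp: lift_def)

lemma lift_less_c_iff: "lift x < c \<longleftrightarrow> x < base_len 1"
proof -
  have "lift (base_len 1) = c" using width_pos by (simp add: lift_def base_len_def)
  then show ?thesis using lift_less_iff[of x "base_len 1"] by simp
qed

lemma break_pts: "break_pt base_len 0 = 0" "break_pt base_len 1 = base_len 1" "break_pt base_len 2 = 1"
  using base_len_sum by (simp_all add: break_pt_def numeral_2_eq_2)

lemma base_interval:
  assumes "x \<in> {0..<1}"
  shows "x < base_len 1 \<Longrightarrow> x \<in> iet_interval base_len 1"
    and "\<not> x < base_len 1 \<Longrightarrow> x \<in> iet_interval base_len 2"
proof -
  have "iet_interval base_len 1 = {0..<base_len 1}" "iet_interval base_len 2 = {base_len 1..<1}"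
    using break_pts by (simp_all add: iet_interval_def)
  then show "x < base_len 1 \<Longrightarrow> x \<in> iet_interval base_len 1"
    "\<not> x < base_len 1 \<Longrightarrow> x \<in> iet_interval base_len 2"
    using assms by auto
qed

lemma base_index:
  assumes "x \<in> {0..<1}"
  shows "iet_index 2 base_len x = (if lift x < c then 1 else 2)"
  using base_interval[OF assms] iet_index_eqI[OF base_data, of 1 x] iet_index_eqI[OF base_data, of 2 x]
  by (auto simp: lift_less_c_iff)

lemma n_index: "x \<in> {0..<1} \<Longrightarrow> n (iet_index 2 base_len x) = height (lift x)"
  by (simp add: base_index height_def)

lemma rot_in: "x \<in> {0..<1} \<Longrightarrow> rot x \<in> {0..<1}"
  using bij_betwE[OF iet_map_bij_betw[OF base_data]] by blast

text \<open>In the coordinate \<open>lift\<close> on the base, the first return map is the rotation: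
  the piece below \<open>c\<close> moves right by \<open>1 - c\<close>, the other left by
  \<open>c - a\<close>.\<close>

lemma lift_rot:
  assumes x: "x \<in> {0..<1}"
  shows "lift (rot x) = (T ^^ height (lift x)) (lift x)"
proof (cases "lift x < c")
  case True
  have "{b \<in> {1..2}. base_perm b < base_perm 1} = {2}" by (auto simp: base_perm_def Transposition.transpose_def)
  then have "rot x = x + base_len 2"
    using iet_map_eq[OF base_data _ base_interval(1)[OF x]] True break_pts(1)
    by (simp add: block_start_def lift_less_c_iff)
  then have "lift (rot x) = lift x + (1 - c)"
    unfolding lift_def by (simp only: distrib_left width_base_len) simp
  then show ?thesis using return_lower[of "lift x"] lift_in[OF x] True by simp
next
  case False
  have "{b \<in> {1..2}. base_perm b < base_perm 2} = {}"
    by (auto simp: base_perm_def Transposition.transpose_def)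
  then have "block_start base_perm {1..2} base_len 2 = 0"
    by (simp only: block_start_def sum.empty)
  then have "rot x = x - base_len 1"
    using iet_map_eq[OF base_data _ base_interval(2)[OF x]] False break_pts(2)
    by (simp add: lift_less_c_iff)
  then have "lift (rot x) = lift x - (c - a)"
    unfolding lift_def by (simp only: right_diff_distrib width_base_len) simp
  then show ?thesis using return_upper[of "lift x"] lift_in[OF x] False by simp
qed

text \<open>An orbit segment of \<open>T\<close> between base points splits into complete returns,
  each of them one step of \<open>rot\<close>: it cannot end before the first return, where the
  iterates lie below \<open>a\<close>.\<close>

lemma orbit_rot:
  assumes "x \<in> {0..<1}" "y \<in> {0..<1}" "(T ^^ k) (lift x) = lift y"
  shows "\<exists>m. y = (rot ^^ m) x"
  using assms
proof (induction k arbitrary: x rule: less_induct)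
  case (less k)
  let ?h = "height (lift x)"
  show ?case
  proof (cases "k = 0")
    case True
    then show ?thesis using less.prems lift_inject by (intro exI[of _ 0]) simp
  next
    case False
    have "\<not> k < ?h"
      using away[of k "lift x"] lift_in[OF less.prems(1)] lift_in[OF less.prems(2)] less.prems(3) False
      by fastforce
    then have "(T ^^ (k - ?h)) (lift (rot x)) = lift y"
      using less.prems by (simp add: lift_rot funpow_add_apply)
    moreover have "k - ?h < k" using False height_pos[of "lift x"] by simp
    ultimately obtain m where "y = (rot ^^ m) (rot x)"
      using less.IH rot_in less.prems(1,2) by blast
    then show ?thesis by (intro exI[of _ "Suc m"]) (simp add: funpow_swap1)
  qed
qed

text \<open>The \<open>T\<close>-orbit of \<open>lift x\<close> enters every short interval to the
  right of \<open>lift y\<close>, and its points in the base are lifts of points in the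
  \<open>rot\<close>-orbit of \<open>x\<close>.\<close>

lemma rot_minimal: "minimal_iet rot"
proof -
  have R: "rot \<in> IETs" using base_data by (auto simp: IETs_def)
  moreover have "y \<in> closure (iet_orbit rot x)" if x: "x \<in> {0..<1}" and y: "y \<in> {0..<1}" for x y
    unfolding closure_approachable
  proof (intro allI impI)
    fix e :: real assume e: "e > 0"
    have lx: "lift x \<in> {0..<1}" using lift_in[OF x] ac by auto
    \<comment> \<open>A one-sided neighbourhood, cut off at 1, stays inside the base.\<close>
    have "0 \<le> lift y" "lift y < min 1 (lift y + width * e)"
      using lift_in[OF y] ac e width_pos by auto
    then obtain w where w: "lift y < w" "w < 1" "w < lift y + width * e" "w \<in> iet_orbit T (lift x)"
      using minimal_orbit_meets[OF minimal lx, of "lift y" "min 1 (lift y + width * e)"] by auto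
    define z where "z = (w - a) / width"
    have z: "z \<in> {0..<1}" "lift z = w"
      using lift_onto[of w] w lift_in[OF y] by (auto simp: z_def)
    obtain k where "w = (T ^^ k) (lift x) \<or> lift x = (T ^^ k) w"
      using w(4) iet_orbit_iff[OF T_IETs lx] by blast
    then have "\<exists>m. z = (rot ^^ m) x \<or> x = (rot ^^ m) z"
      using orbit_rot[OF x z(1), of k] orbit_rot[OF z(1) x, of k] z(2) by metis
    then have "z \<in> iet_orbit rot x" using iet_orbit_iff[OF R x] z(1) by blast
    moreover have "y < z" using w(1) z(2) lift_less_iff by metis
    moreover have "z < y + e"
    proof -
      have "lift z < lift (y + e)" using w(3) z(2) by (simp add: lift_def algebra_simps)
      then show ?thesis by (simp add: lift_less_iff)
    qed
    ultimately show "\<exists>z\<in>iet_orbit rot x. dist z y < e"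
      by (intro bexI[of _ z]) (auto simp: dist_real_def)
  qed
  ultimately show ?thesis unfolding minimal_iet_def by blast
qed

section \<open>Identifying the tower with the unit interval\<close>

lemma levels_iff: "(x, i) \<in> levels \<longleftrightarrow> x \<in> {0..<1} \<and> 1 \<le> i \<and> i \<le> height (lift x)"
  using n_index by (auto simp: tower_dom_def)

lemma climb_bij_betw: "bij_betw climb levels {0..<1}"
proof (rule bij_betwI')
  fix z z' assume z: "z \<in> levels" "z' \<in> levels"
  obtain x i x' i' where zz: "z = (x, i)" "z' = (x', i')" by (cases z, cases z') auto
  have d: "x \<in> {0..<1}" "1 \<le> i" "i \<le> height (lift x)" "x' \<in> {0..<1}" "1 \<le> i'" "i' \<le> height (lift x')"
    using z unfolding zz levels_iff by blast+
  show "(climb z = climb z') = (z = z')"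
  proof
    assume "climb z = climb z'"
    then have "(T ^^ (i - 1)) (lift x) = (T ^^ (i' - 1)) (lift x')" by (simp add: climb_def zz)
    then have "lift x = lift x' \<and> i - 1 = i' - 1"
      using d lift_in[OF d(1)] lift_in[OF d(4)] by (intro climb_unique) auto
    then show "z = z'" using d lift_inject zz by auto
  qed simp
next
  fix z assume "z \<in> levels"
  moreover obtain x i where zz: "z = (x, i)" by (cases z)
  ultimately have "x \<in> {0..<1}" by (simp add: levels_iff)
  then show "climb z \<in> {0..<1}" using in01 lift_in unfolding zz climb_def by simp
next
  fix y :: real assume "y \<in> {0..<1}"
  then obtain x i where x: "a \<le> x" "x < 1" "i < height x" "y = (T ^^ i) x"
    using unit_subset_climbs[of y] unfolding climbs_def by blast
  have "((x - a) / width, Suc i) \<in> levels" using lift_onto[OF x(1,2)] x(3) by (simp add: levels_iff)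
  moreover have "y = climb ((x - a) / width, Suc i)"
    using lift_onto[OF x(1,2)] x(4) by (simp add: climb_def)
  ultimately show "\<exists>z\<in>levels. y = climb z" by blast
qed

lemma climb_step:
  assumes "z \<in> levels"
  shows "climb (tower_step 2 base_perm base_len n z) = T (climb z)"
proof -
  obtain x i where zz: "z = (x, i)" by (cases z)
  have d: "x \<in> {0..<1}" "1 \<le> i" "i \<le> height (lift x)"
    using assms unfolding zz levels_iff by blast+
  have i: "T (climb z) = (T ^^ i) (lift x)"
    using d(2) by (cases i) (simp_all add: zz climb_def)
  show ?thesis
  proof (cases "i + 1 \<le> height (lift x)")
    case True
    then show ?thesis unfolding i by (simp add: zz tower_step_def n_index[OF d(1)] climb_def)
  next
    case False
    then have "i = height (lift x)" using d by simp
    then show ?thesis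
      unfolding i by (simp add: zz tower_step_def n_index[OF d(1)] climb_def lift_rot[OF d(1)])
  qed
qed

text \<open>Kac's formula: in their true lengths \<open>c - a\<close> and \<open>1 - c\<close> the
  levels tile \<open>[0,1)\<close>, and the base was stretched by \<open>1 / width\<close>. As
  \<open>tower_pos\<close> divides by this total, the two rescalings cancel.\<close>

lemma total_length: "(\<Sum>j\<in>{1..2}. real (n j) * base_len j) = 1 / width"
proof -
  define b where "b j = (if j = 1 then a else c)" for j :: nat
  define A where "A = (SIGMA j:{1..2::nat}. {..<n j})"
  define e where "e = (\<lambda>(j, i). (T ^^ i) (b j))"
  define w where "w = (\<lambda>(j :: nat, i :: nat). width * base_len j)"
  have two: "{1..2::nat} = {1, 2}" by auto
  note wb = width_base_len
  \<comment> \<open>Each point of a level interval comes from a base point over the same piece;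
    \<open>climb_unique\<close> can then compare two level intervals through a common point.\<close>
  have piece: "\<exists>x. a \<le> x \<and> x < 1 \<and> i < height x \<and> y = (T ^^ i) x \<and> (if x < c then 1 else 2) = j"
    if "(j, i) \<in> A" "y \<in> {e (j, i)..<e (j, i) + w (j, i)}" for j i y
  proof -
    let ?x = "b j + (y - e (j, i))"
    have j: "j = 1 \<or> j = 2" "i < n j" using that(1) by (auto simp: A_def two)
    have x: "b j \<le> ?x" "?x < b j + width * base_len j" using that(2) by (auto simp: w_def)
    have h: "height ?x = n j" "floor_pt ?x = b j" "a \<le> ?x" "?x < 1" "(if ?x < c then 1 else 2) = j"
      using x j(1) ac unfolding wb by (auto simp: height_def floor_pt_def b_def)
    have "(T ^^ i) ?x = y"
      using translate[of i ?x] h j(2) by (simp add: e_def)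
    then show ?thesis using h j(2) by (intro exI[of _ ?x]) simp
  qed
  have "sum w A = 1 - 0"
  proof (rule sum_lengths_of_partition[where e = e])
    show "finite A" by (auto simp: A_def)
    show "0 \<le> w z" if "z \<in> A" for z
      using width_pos base_len_pos by (auto simp: w_def intro!: mult_nonneg_nonneg less_imp_le split: prod.splits)
    show "(\<Union>z\<in>A. {e z..<e z + w z}) = {0..<1}"
    proof (intro equalityI subsetI)
      fix y assume "y \<in> (\<Union>z\<in>A. {e z..<e z + w z})"
      then obtain j i where "(j, i) \<in> A" "y \<in> {e (j, i)..<e (j, i) + w (j, i)}" by force
      then show "y \<in> {0..<1}" using piece in01 by blast
    next
      fix y :: real assume "y \<in> {0..<1}"
      then obtain x i where x: "a \<le> x" "x < 1" "i < height x" "y = (T ^^ i) x"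
        using unit_subset_climbs[of y] unfolding climbs_def by blast
      define j :: nat where "j = (if x < c then 1 else 2)"
      have j: "(j, i) \<in> A" using x(3) by (auto simp: A_def j_def height_def)
      have f: "floor_pt x = b j" by (simp add: floor_pt_def b_def j_def)
      have "y = e (j, i) + (x - b j)"
        using translate[of i x] x unfolding f by (simp add: e_def)
      moreover have "b j \<le> x" "x < b j + w (j, i)"
        using x ac wb[of j] by (auto simp: b_def j_def w_def)
      ultimately have "y \<in> {e (j, i)..<e (j, i) + w (j, i)}" by auto
      then show "y \<in> (\<Union>z\<in>A. {e z..<e z + w z})" using j by blast
    qed
    show "disjoint_family_on (\<lambda>z. {e z..<e z + w z}) A"
      unfolding disjoint_family_on_def
    proof (intro ballI impI)
      fix z z' assume z: "z \<in> A" "z' \<in> A" "z \<noteq> z'"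
      obtain j i j' i' where zz: "z = (j, i)" "z' = (j', i')" by (cases z, cases z') auto
      show "{e z..<e z + w z} \<inter> {e z'..<e z' + w z'} = {}"
      proof (rule ccontr)
        assume "{e z..<e z + w z} \<inter> {e z'..<e z' + w z'} \<noteq> {}"
        then obtain y where "y \<in> {e z..<e z + w z}" "y \<in> {e z'..<e z' + w z'}" by blast
        then obtain x x' where "a \<le> x" "x < 1" "i < height x" "y = (T ^^ i) x" "(if x < c then 1 else 2) = j"
          "a \<le> x'" "x' < 1" "i' < height x'" "y = (T ^^ i') x'" "(if x' < c then 1 else 2) = j'"
          using piece[of j i y] piece[of j' i' y] z unfolding zz by blast
        then show False using climb_unique[of x i x' i'] z(3) zz by simp
      qed
    qed
  qed simp
  moreover have "sum w A = (\<Sum>j\<in>{1..2}. \<Sum>i<n j. width * base_len j)"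
    unfolding A_def w_def by (subst sum.Sigma) auto
  ultimately have "width * (\<Sum>j\<in>{1..2}. real (n j) * base_len j) = 1"
    by (simp add: sum_distrib_left mult.left_commute)
  then show ?thesis using width_pos by (simp add: field_simps)
qed

text \<open>The conjugating map: it moves each level from its place under the iterates of
  \<open>T\<close> to its place in the laid-out tower.\<close>

definition rearrangement :: "real \<Rightarrow> real" where
  "rearrangement = (\<lambda>y\<in>{0..<1}. tower_pos 2 base_len n (inv_into levels climb y))"

lemma rearrangement_climb: "z \<in> levels \<Longrightarrow> rearrangement (climb z) = tower_pos 2 base_len n z"
  using bij_betw_inv_into_left[OF climb_bij_betw] bij_betwE[OF climb_bij_betw]
  by (simp add: rearrangement_def)

lemma n_pos: "j \<in> {1..2} \<Longrightarrow> n j \<ge> 1"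
proof -
  assume "j \<in> {1..2}"
  then have "j = 1 \<or> j = 2" by auto
  then show ?thesis using n1 n2 by auto
qed

lemma pos_bij_betw: "bij_betw (tower_pos 2 base_len n) levels {0..<1}"
  by (rule tower_pos_bij_betw[OF base_data n_pos])

lemma rearrangement_bij_betw: "bij_betw rearrangement {0..<1} {0..<1}"
proof -
  have "bij_betw (tower_pos 2 base_len n \<circ> inv_into levels climb) {0..<1} {0..<1}"
    by (rule bij_betw_trans[OF bij_betw_inv_into[OF climb_bij_betw] pos_bij_betw])
  then show ?thesis by (simp add: rearrangement_def bij_betw_def inj_on_def image_def)
qed

lemma rearrangement_at:
  assumes "a \<le> x" "x < 1" "i < height x"
  shows "rearrangement ((T ^^ i) x) = tower_pos 2 base_len n ((x - a) / width, Suc i)"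
proof -
  have "((x - a) / width, Suc i) \<in> levels" using lift_onto[OF assms(1,2)] assms(3) by (simp add: levels_iff)
  from rearrangement_climb[OF this] show ?thesis using lift_onto[OF assms(1,2)] by (simp add: climb_def)
qed

text \<open>Breaks occur only at left ends of levels. Inside one level the position in the tower
  varies with the base coordinate alone, with slope one by Kac's formula.\<close>

lemma rearrangement_IETs: "rearrangement \<in> IETs"
proof (rule iet_of_piecewise_translation)
  let ?F = "(\<lambda>i. (T ^^ i) a) ` {..<n 1} \<union> (\<lambda>i. (T ^^ i) c) ` {..<n 2}"
  show "rearrangement \<in> extensional {0..<1}" by (simp add: rearrangement_def)
  show "bij_betw rearrangement {0..<1} {0..<1}" by (rule rearrangement_bij_betw)
  show "piecewise_translation ?F rearrangement"
    unfolding piecewise_translation_def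
  proof (intro conjI allI impI)
    show "finite ?F" by simp
    fix x y :: real
    assume xy: "0 \<le> x" "x < y" "y < 1" "{x<..y} \<inter> ?F = {}"
    then obtain Y i where Y: "a \<le> Y" "Y < 1" "i < height Y" "y = (T ^^ i) Y"
      using unit_subset_climbs[of y] by (auto simp: climbs_def)
    \<comment> \<open>The left end of the level that contains \<open>y\<close>. Being one of the
      breaks it is not in \<open>{x<..y}\<close>, so \<open>x\<close> lies on the same level, over
      the base point \<open>X\<close> below.\<close>
    define e where "e = (T ^^ i) (floor_pt Y)"
    have y: "y = e + (Y - floor_pt Y)" using translate[of i Y] Y by (simp add: e_def)
    have fY: "floor_pt Y \<le> Y" using Y by (simp add: floor_pt_def)
    have "e \<in> ?F" using Y(3) by (auto simp: e_def floor_pt_def height_def)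
    then have "e \<notin> {x<..y}" using xy(4) by blast
    then have ex: "e \<le> x" using y fY by auto
    define X where "X = floor_pt Y + (x - e)"
    have X: "floor_pt Y \<le> X" "X < Y" using ex y xy(2) by (auto simp: X_def)
    have side: "X < c \<longleftrightarrow> Y < c" using X by (auto simp: floor_pt_def split: if_splits)
    then have same: "floor_pt X = floor_pt Y" "height X = height Y"
      by (simp_all add: floor_pt_def height_def)
    have X': "a \<le> X" "X < 1" using X Y ac by (auto simp: floor_pt_def split: if_splits)
    have xX: "x = (T ^^ i) X"
      using translate[of i X] X' Y(3) same by (simp add: e_def[symmetric] X_def)
    let ?x = "(X - a) / width" and ?y = "(Y - a) / width"
    have idx: "iet_index 2 base_len ?x = iet_index 2 base_len ?y"
      using base_index lift_onto[OF X'] lift_onto[OF Y(1,2)] side by simp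
    define j where "j = iet_index 2 base_len ?y"
    \<comment> \<open>The part of the position that depends only on the level and the base interval,
      hence is common to \<open>x\<close> and \<open>y\<close>.\<close>
    define K where "K = (\<Sum>k\<in>{1..<Suc i}. \<Sum>j' | j' \<in> {1..2} \<and> k \<le> n j'. base_len j')
      + (\<Sum>j' | j' \<in> {1..2} \<and> j' < j \<and> Suc i \<le> n j'. base_len j') - break_pt base_len (j - 1)"
    have "tower_pos 2 base_len n (?y, Suc i) = (K + ?y) / (1 / width)"
      unfolding tower_pos_def case_prod_conv Let_def total_length j_def[symmetric] K_def
      by (rule arg_cong[where f = "\<lambda>t. t / (1 / width)"]) linarith
    moreover have "tower_pos 2 base_len n (?x, Suc i) = (K + ?x) / (1 / width)"
      unfolding tower_pos_def case_prod_conv Let_def total_length idx j_def[symmetric] K_def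
      by (rule arg_cong[where f = "\<lambda>t. t / (1 / width)"]) linarith
    ultimately have "rearrangement y = (K + ?y) * width" "rearrangement x = (K + ?x) * width"
      using rearrangement_at[OF Y(1-3)] rearrangement_at[OF X', of i] Y(3,4) same xX by simp_all
    then have "rearrangement y - rearrangement x = Y - X"
      using width_pos by (simp add: distrib_right)
    also have "Y - X = y - x" using y by (simp add: X_def)
    finally show "rearrangement y - y = rearrangement x - x" by simp
  qed
qed

lemma tower_conjugate: "conjugate_in IET_group T (tower_iet 2 base_perm base_len n)"
proof (rule conjugate_in_IET_groupI[OF T_IETs rearrangement_IETs])
  let ?pos = "tower_pos 2 base_len n" and ?step = "tower_step 2 base_perm base_len n"
  show "tower_iet 2 base_perm base_len n \<in> extensional {0..<1}" by (simp add: tower_iet_def)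
  fix x :: real assume x: "x \<in> {0..<1}"
  define z where "z = inv_into levels climb x"
  have z: "z \<in> levels" "climb z = x"
    using bij_betwE[OF bij_betw_inv_into[OF climb_bij_betw]] bij_betw_inv_into_right[OF climb_bij_betw] x
    by (auto simp: z_def)
  have step: "?step z \<in> levels" by (rule tower_step_in_dom[OF base_data n_pos z(1)])
  have "rearrangement x = ?pos z" using rearrangement_climb[OF z(1)] z(2) by simp
  moreover from this have "rearrangement x \<in> {0..<1}" using bij_betwE[OF pos_bij_betw] z(1) by simp
  moreover have "inv_into levels ?pos (?pos z) = z" by (rule bij_betw_inv_into_left[OF pos_bij_betw z(1)])
  ultimately have "tower_iet 2 base_perm base_len n (rearrangement x) = ?pos (?step z)"
    by (simp add: tower_iet_def)
  also have "\<dots> = rearrangement (T x)" using rearrangement_climb[OF step] climb_step[OF z(1)] z(2) by simp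
  finally show "tower_iet 2 base_perm base_len n (rearrangement x) = rearrangement (T x)" .
qed

end

theorem theorem1p7:
  fixes T :: "real \<Rightarrow> real"
  assumes "T \<in> IETs"
    and "minimal_iet T"
    and "\<exists>x\<in>{0..<1}. discontinuities T \<subseteq> iet_orbit T x"
  shows "\<exists>(p :: nat \<Rightarrow> nat) (l :: nat \<Rightarrow> real) (n :: nat \<Rightarrow> nat).
           rotation_data p l \<and> minimal_iet (iet_map 2 p l) \<and>
           (\<forall>j\<in>{1..2}. n j \<ge> 1) \<and>
           conjugate_in IET_group T (tower_iet 2 p l n)"
proof -
  obtain x where "x \<in> {0..<1}" "discontinuities T \<subseteq> iet_orbit T x" using assms(3) by blast
  then obtain a c n where "rotation_base T a c n"
    using rotation_base_exists[OF assms(1,2)] by blast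
  then interpret rotation_base T a c n .
  show ?thesis using base_rotation rot_minimal n_pos tower_conjugate by blast
qed

end
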